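(* Let $K_n$ denote the complete graph on $n$ vertices. For all positive integers $r$, $\mathrm{reg}(R_{K_n}/I_r(K_n))=r$.
   Context: $\mathbb K$ is a field. For a finite simple graph $G$ with vertex set $V(G)$, $R_G$ is the polynomial ring over $\mathbb K$ whose variables are the vertices of $G$ (standard grading). For a positive integer $r$, $I_r(G)\subseteq R_G$ is the square-free monomial ideal generated by the monomials $\prod_{x\in A}x$, where $A$ ranges over all subsets $A\subseteq V(G)$ with $|A|=r+1$ such that the induced subgraph $G[A]$ is connected. $\beta_{i,j}(R/I)$ denotes the $(i,j)$-th graded Betti number of $R/I$, i.e. the multiplicity of $R(-j)$ in homological degree $i$ of its graded minimal free resolution, and the Castelnuovo-Mumford regularity is $\mathrm{reg}(R/I)=\max\{j-i\mid \beta_{i,j}(R/I)\ne 0\}$.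
   Formalization: The formal theorem assumes r < n: for r ≥ n there are no vertex subsets of size r+1, so I_r(K_n) = 0 and the regularity of the quotient is 0, not r (e.g. n = r = 1). *)

theory Defs
  imports
    "HOL-Library.Poly_Mapping"
    "Graph_Theory.Graph_Theory"
    "Jordan_Normal_Form.Matrix_Kernel"
begin

text \<open>
  The polynomial ring over \<open>'k\<close> whose variables are the elements of \<open>'v\<close>: exponent vectors are
  finitely supported maps \<open>'v \<Rightarrow>\<^sub>0 nat\<close>. For a graph \<open>G\<close> with \<open>verts G = UNIV\<close> this is the ring
  $R_G$.
\<close>

type_synonym ('v, 'k) mpoly = "('v \<Rightarrow>\<^sub>0 nat) \<Rightarrow>\<^sub>0 'k"

definition var :: "'v \<Rightarrow> ('v, 'k::field) mpoly" where
  "var x = Poly_Mapping.single (Poly_Mapping.single x 1) 1"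

abbreviation ideal_gen :: "'a::comm_ring_1 set \<Rightarrow> 'a set" where
  "ideal_gen \<equiv> Modules.module.span (*)"

definition conn_ideal :: "nat \<Rightarrow> ('v, 'e) pre_digraph \<Rightarrow> ('v, 'k::field) mpoly set" where
  "conn_ideal r G = ideal_gen
     {(\<Prod>x\<in>A. var x) | A. A \<subseteq> verts G \<and> card A = r + 1 \<and> connected (G \<restriction> A)}"

definition irrelevant_ideal :: "('v, 'k::field) mpoly set" where
  "irrelevant_ideal = ideal_gen (range var)"

definition monom_degree :: "('v \<Rightarrow>\<^sub>0 nat) \<Rightarrow> nat" where
  "monom_degree m = (\<Sum>x\<in>Poly_Mapping.keys m. Poly_Mapping.lookup m x)"

text \<open>Zero is homogeneous of every degree, and it is the only form of negative degree.\<close>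

definition homogeneous :: "int \<Rightarrow> ('v, 'k::field) mpoly \<Rightarrow> bool" where
  "homogeneous d p \<longleftrightarrow> (\<forall>m\<in>Poly_Mapping.keys p. int (monom_degree m) = d)"

text \<open>
  A list \<open>[d\<^sub>1, \<dots>, d\<^sub>b]\<close> of integers stands for the graded free module
  $R(-d_1) \oplus \dots \oplus R(-d_b)$, whose elements are the vectors in \<open>carrier_vec b\<close> and whose
  \<open>k\<close>-th basis vector has degree \<open>d\<^sub>k\<close>. \<open>graded_mat es ds A\<close> says that \<open>A\<close> is the matrix of a
  homogeneous map of degree 0 from the module of \<open>ds\<close> to the module of \<open>es\<close>.
\<close>

definition graded_mat :: "int list \<Rightarrow> int list \<Rightarrow> ('v, 'k::field) mpoly mat \<Rightarrow> bool" where
  "graded_mat es ds A \<longleftrightarrow> A \<in> carrier_mat (length es) (length ds) \<and>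
     (\<forall>l < length es. \<forall>k < length ds. homogeneous (ds ! k - es ! l) (A $$ (l, k)))"

definition mat_image :: "'a::comm_ring_1 mat \<Rightarrow> 'a vec set" where
  "mat_image A = (\<lambda>w. A *\<^sub>v w) ` carrier_vec (dim_col A)"

text \<open>
  A minimal graded free resolution of $R/I$ for a homogeneous ideal $I$,
  \[ \dots \to F_2 \to F_1 \to F_0 \to R/I \to 0. \]
  The module $F_i$ has shifts \<open>d i\<close>, the map from $F_{i+1}$ to $F_i$ has matrix \<open>\<phi> i\<close>, and the
  augmentation sends \<open>v\<close> to the class of \<open>g \<bullet> v\<close> modulo \<open>I\<close>. Minimality means that the image of
  each \<open>\<phi> i\<close> lies in $\mathfrak m F_i$ for the irrelevant ideal $\mathfrak m$.
\<close>

definition minimal_graded_free_resolution ::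
  "('v, 'k::field) mpoly set \<Rightarrow> (nat \<Rightarrow> int list) \<Rightarrow> ('v, 'k) mpoly vec \<Rightarrow>
     (nat \<Rightarrow> ('v, 'k) mpoly mat) \<Rightarrow> bool" where
  "minimal_graded_free_resolution I d g \<phi> \<longleftrightarrow>
     g \<in> carrier_vec (length (d 0)) \<and>
     (\<forall>k < length (d 0). homogeneous (d 0 ! k) (g $ k)) \<and>
     (\<forall>i. graded_mat (d i) (d (Suc i)) (\<phi> i)) \<and>
     (\<forall>f. \<exists>v \<in> carrier_vec (length (d 0)). f - g \<bullet> v \<in> I) \<and>
     mat_image (\<phi> 0) = {v \<in> carrier_vec (length (d 0)). g \<bullet> v \<in> I} \<and>
     (\<forall>i. mat_image (\<phi> (Suc i)) = mat_kernel (\<phi> i)) \<and>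
     (\<forall>i. elements_mat (\<phi> i) \<subseteq> irrelevant_ideal)"

text \<open>
  For a homogeneous ideal in finitely many variables a minimal graded free resolution exists and is
  unique up to isomorphism, so the multiplicities of its shifts do not depend on the choice.
\<close>

definition minimal_shifts :: "('v, 'k::field) mpoly set \<Rightarrow> nat \<Rightarrow> int list" where
  "minimal_shifts I = (SOME d. \<exists>g \<phi>. minimal_graded_free_resolution I d g \<phi>)"

text \<open>\<open>betti I i j\<close> is $\beta_{i,j}(R/I)$, and \<open>regularity I\<close> is the regularity of $R/I$, not of $I$.\<close>

definition betti :: "('v, 'k::field) mpoly set \<Rightarrow> nat \<Rightarrow> int \<Rightarrow> nat" where
  "betti I i j = count_list (minimal_shifts I i) j"

definition regularity :: "('v, 'k::field) mpoly set \<Rightarrow> int" where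
  "regularity I = Max {j - int i | i j. betti I i j \<noteq> 0}"

end

theory Submission
  imports Defs
begin

text \<open>
  For a complete graph, \<open>conn_ideal r G\<close> is generated by all squarefree monomials of degree $r + 1$.
  Ordered by the sum of their vertex labels, they have linear quotients: each colon ideal of a
  generator by its predecessors is generated by variables. Read on syzygies, this says that the
  leading coefficients of the syzygies ending at a given position form an ideal generated by
  variables. Lifting each such variable to a linear syzygy gives generators of the syzygy module
  which have the same property in the next degree, so that iteration gives a minimal resolution in
  which every step is linear. Any minimal resolution is linear as well: two minimal graded covers
  of a module one of which is generated in a single degree differ by an invertible scalar matrix,
  and the property passes from one syzygy module to the other.
\<close>

section \<open>Monomial ideals\<close>

text \<open>An ideal is a submodule of the ring over itself, so \<open>ideal.subspace\<close> stands
  for ideals and the general facts on spans apply to \<open>ideal_gen\<close>.\<close>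

interpretation ideal: Modules.module "(*) :: 'a::comm_ring_1 \<Rightarrow> 'a \<Rightarrow> 'a"
  by standard (simp_all add: algebra_simps)

lemma ideal_gen_mult_right: "p \<in> ideal_gen S \<Longrightarrow> p * q \<in> ideal_gen S"
  using ideal.span_scale[of p S q] by (simp add: mult.commute)

definition sqfree :: "'v set \<Rightarrow> ('v, 'k::field) mpoly" where
  "sqfree A = (\<Prod>x\<in>A. var x)"

definition sqfree_exp :: "'v set \<Rightarrow> 'v \<Rightarrow>\<^sub>0 nat" where
  "sqfree_exp A = (\<Sum>x\<in>A. Poly_Mapping.single x 1)"

lemma sqfree_eq_single: "sqfree A = Poly_Mapping.single (sqfree_exp A) 1"
  by (induction A rule: infinite_finite_induct)
    (simp_all add: sqfree_def sqfree_exp_def var_def mult_single)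

lemma lookup_sqfree_exp: "finite A \<Longrightarrow> Poly_Mapping.lookup (sqfree_exp A) x = (if x \<in> A then 1 else 0)"
  by (simp add: sqfree_exp_def lookup_sum lookup_single when_def)

lemma keys_add_nat: "Poly_Mapping.keys (k + l :: 'v \<Rightarrow>\<^sub>0 nat) = Poly_Mapping.keys k \<union> Poly_Mapping.keys l"
  by (auto simp: in_keys_iff lookup_add)

lemma keys_sqfree_exp: "finite A \<Longrightarrow> Poly_Mapping.keys (sqfree_exp A) = A"
  by (auto simp: in_keys_iff lookup_sqfree_exp split: if_splits)

lemma subset_keys_imp_split:
  assumes "finite A" "A \<subseteq> Poly_Mapping.keys k"
  shows "\<exists>l. k = sqfree_exp A + l"
proof
  show "k = sqfree_exp A + (k - sqfree_exp A)"
    using assms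
    by (intro poly_mapping_eqI) (auto simp: lookup_add lookup_minus lookup_sqfree_exp in_keys_iff)
qed

text \<open>Exponents can be cancelled, so only the term of \<open>p\<close> with exponent
  \<open>k\<close> contributes: multiplying by a monomial shifts the terms and merges none of
  them.\<close>

lemma lookup_mult_sqfree:
  fixes p :: "('v, 'k::field) mpoly"
  shows "Poly_Mapping.lookup (p * sqfree A) (k + sqfree_exp A) = Poly_Mapping.lookup p k"
proof -
  let ?m = "sqfree_exp A"
  have "Sum_any (\<lambda>q. Poly_Mapping.lookup (Poly_Mapping.single ?m (1::'k)) q when k + ?m = l + q) =
      (1 when l = k)" for l
  proof -
    have "(Poly_Mapping.lookup (Poly_Mapping.single ?m (1::'k)) q when k + ?m = l + q) =
        ((1 when l = k) when q = ?m)" for q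
      by (auto simp: lookup_single when_def)
    then show ?thesis
      by (simp only: Sum_any_when_equal)
  qed
  then have "Poly_Mapping.lookup (p * sqfree A) (k + ?m) =
      Sum_any (\<lambda>l. Poly_Mapping.lookup p l * (1 when l = k))"
    by (simp only: sqfree_eq_single lookup_mult)
  also have "\<dots> = Sum_any (\<lambda>l. Poly_Mapping.lookup p l when l = k)"
    by (rule Sum_any.cong) (simp add: when_def)
  also have "\<dots> = Poly_Mapping.lookup p k"
    by (rule Sum_any_when_equal)
  finally show ?thesis .
qed

lemma sum_single_keys:
  "(\<Sum>k\<in>Poly_Mapping.keys p. Poly_Mapping.single k (Poly_Mapping.lookup p k)) = p"
  by (rule poly_mapping_eqI) (auto simp: lookup_sum lookup_single when_def in_keys_iff)

text \<open>Membership in a monomial ideal is decided term by term. The polynomials described on the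
  right form an ideal containing the generators; conversely each of their terms is a multiple of a
  generator, because a squarefree monomial divides every monomial whose support contains its
  own.\<close>

lemma mem_sqfree_ideal:
  fixes p :: "('v, 'k::field) mpoly"
  assumes fin: "\<And>A. A \<in> \<A> \<Longrightarrow> finite A"
  shows "p \<in> ideal_gen (sqfree ` \<A>) \<longleftrightarrow>
    (\<forall>k\<in>Poly_Mapping.keys p. \<exists>A\<in>\<A>. A \<subseteq> Poly_Mapping.keys k)"
proof
  let ?T = "{p :: ('v, 'k) mpoly. \<forall>k\<in>Poly_Mapping.keys p. \<exists>A\<in>\<A>. A \<subseteq> Poly_Mapping.keys k}"
  have "ideal_gen (sqfree ` \<A>) \<subseteq> ?T"
  proof (rule ideal.span_minimal)
    show "sqfree ` \<A> \<subseteq> ?T"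
      using fin by (auto simp: sqfree_eq_single keys_sqfree_exp)
    show "ideal.subspace ?T"
    proof (rule ideal.subspaceI)
      show "0 \<in> ?T" by simp
      fix p q :: "('v, 'k) mpoly" assume "p \<in> ?T" "q \<in> ?T"
      then show "p + q \<in> ?T"
        using keys_add[of p q] by blast
    next
      fix c p :: "('v, 'k) mpoly" assume p: "p \<in> ?T"
      show "c * p \<in> ?T"
      proof safe
        fix k assume "k \<in> Poly_Mapping.keys (c * p)"
        then obtain a b where "k = a + b" "b \<in> Poly_Mapping.keys p"
          using keys_mult by blast
        moreover from p \<open>b \<in> _\<close> obtain A where "A \<in> \<A>" "A \<subseteq> Poly_Mapping.keys b"
          by auto
        ultimately show "\<exists>A\<in>\<A>. A \<subseteq> Poly_Mapping.keys k"
          by (intro bexI[of _ A]) (auto simp: keys_add_nat)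
      qed
    qed
  qed
  then show "p \<in> ideal_gen (sqfree ` \<A>) \<Longrightarrow>
      \<forall>k\<in>Poly_Mapping.keys p. \<exists>A\<in>\<A>. A \<subseteq> Poly_Mapping.keys k"
    by blast
next
  assume *: "\<forall>k\<in>Poly_Mapping.keys p. \<exists>A\<in>\<A>. A \<subseteq> Poly_Mapping.keys k"
  have "(\<Sum>k\<in>Poly_Mapping.keys p. Poly_Mapping.single k (Poly_Mapping.lookup p k))
      \<in> ideal_gen (sqfree ` \<A>)"
  proof (rule ideal.span_sum)
    fix k assume "k \<in> Poly_Mapping.keys p"
    with * obtain A where A: "A \<in> \<A>" "A \<subseteq> Poly_Mapping.keys k"
      by blast
    with fin obtain l where k: "k = sqfree_exp A + l"
      using subset_keys_imp_split by blast
    have "Poly_Mapping.single k (Poly_Mapping.lookup p k) =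
        sqfree A * Poly_Mapping.single l (Poly_Mapping.lookup p k)"
      by (simp add: sqfree_eq_single mult_single k)
    then show "Poly_Mapping.single k (Poly_Mapping.lookup p k) \<in> ideal_gen (sqfree ` \<A>)"
      using A by (simp add: ideal.span_base ideal_gen_mult_right)
  qed
  then show "p \<in> ideal_gen (sqfree ` \<A>)"
    by (simp only: sum_single_keys)
qed

text \<open>No terms cancel in \<open>p * sqfree B\<close>, so an element \<open>p\<close> of the
  colon ideal by \<open>sqfree B\<close> can be examined one exponent at a time.\<close>

lemma mult_sqfree_mem_ideal:
  fixes p :: "('v, 'k::field) mpoly"
  assumes "\<And>A. A \<in> \<A> \<Longrightarrow> finite A" "finite B"
    and "p * sqfree B \<in> ideal_gen (sqfree ` \<A>)" "k \<in> Poly_Mapping.keys p"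
  shows "\<exists>A\<in>\<A>. A \<subseteq> Poly_Mapping.keys k \<union> B"
proof -
  have "k + sqfree_exp B \<in> Poly_Mapping.keys (p * sqfree B)"
    using assms(4) by (simp add: in_keys_iff lookup_mult_sqfree)
  moreover have "\<forall>k\<in>Poly_Mapping.keys (p * sqfree B). \<exists>A\<in>\<A>. A \<subseteq> Poly_Mapping.keys k"
    using assms(3) mem_sqfree_ideal[of \<A>] assms(1) by blast
  ultimately have "\<exists>A\<in>\<A>. A \<subseteq> Poly_Mapping.keys (k + sqfree_exp B)"
    by blast
  then show ?thesis
    by (simp only: keys_add_nat keys_sqfree_exp[OF assms(2)])
qed

lemma var_eq_sqfree: "var x = sqfree {x}"
  by (simp add: sqfree_def)

lemma var_image_eq: "var ` S = sqfree ` (\<lambda>x. {x}) ` S"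
  by (auto simp: image_iff var_eq_sqfree)

lemma mem_var_ideal:
  "p \<in> ideal_gen (var ` S) \<longleftrightarrow> (\<forall>k\<in>Poly_Mapping.keys p. Poly_Mapping.keys k \<inter> S \<noteq> {})"
proof -
  have "p \<in> ideal_gen (var ` S) \<longleftrightarrow>
      (\<forall>k\<in>Poly_Mapping.keys p. \<exists>A\<in>(\<lambda>x. {x}) ` S. A \<subseteq> Poly_Mapping.keys k)"
    unfolding var_image_eq by (rule mem_sqfree_ideal) auto
  also have "\<dots> \<longleftrightarrow> (\<forall>k\<in>Poly_Mapping.keys p. Poly_Mapping.keys k \<inter> S \<noteq> {})"
    by (rule ball_cong) auto
  finally show ?thesis .
qed

text \<open>An ideal generated by variables is prime, so a variable outside the generating set can
  be cancelled.\<close>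

lemma mult_var_mem_var_ideal:
  assumes "p * var x \<in> ideal_gen (var ` S)" "x \<notin> S"
  shows "p \<in> ideal_gen (var ` S)"
  unfolding mem_var_ideal
proof
  fix k assume "k \<in> Poly_Mapping.keys p"
  with assms(1) obtain A where "A \<in> (\<lambda>x. {x}) ` S" "A \<subseteq> Poly_Mapping.keys k \<union> {x}"
    using mult_sqfree_mem_ideal[of "(\<lambda>x. {x}) ` S" "{x}" p k]
    unfolding var_image_eq var_eq_sqfree by blast
  with assms(2) show "Poly_Mapping.keys k \<inter> S \<noteq> {}"
    by auto
qed

lemma mem_irrelevant_ideal: "p \<in> irrelevant_ideal \<longleftrightarrow> Poly_Mapping.lookup p 0 = 0"
proof -
  have "Poly_Mapping.keys k = {} \<longleftrightarrow> k = 0" for k :: "'a \<Rightarrow>\<^sub>0 nat"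
    by (auto simp: poly_mapping_eq_iff in_keys_iff fun_eq_iff set_eq_iff)
  then have "p \<in> irrelevant_ideal \<longleftrightarrow> 0 \<notin> Poly_Mapping.keys p"
    unfolding irrelevant_ideal_def mem_var_ideal by auto
  then show ?thesis
    by (simp add: in_keys_iff)
qed

text \<open>The combinations form an ideal containing the generators. Coefficients are indexed by
  \<open>S\<close> rather than by the values of \<open>g\<close>, so repeated values are
  harmless.\<close>

lemma mem_ideal_gen_image:
  fixes p :: "'a::comm_ring_1"
  assumes "finite S" "p \<in> ideal_gen (g ` S)"
  shows "\<exists>c. p = (\<Sum>s\<in>S. c s * g s)"
proof -
  let ?h = "\<lambda>c. \<Sum>s\<in>S. c s * g s"
  have "ideal_gen (g ` S) \<subseteq> range ?h"
  proof (rule ideal.span_minimal)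
    show "g ` S \<subseteq> range ?h"
    proof safe
      fix s assume "s \<in> S"
      then have "g s = ?h (\<lambda>t. if t = s then 1 else 0)"
        using assms(1) by (simp add: if_distrib[of "\<lambda>x. x * _"] cong: if_cong)
      then show "g s \<in> range ?h" by (rule range_eqI[where f = ?h])
    qed
    show "ideal.subspace (range ?h)"
    proof (rule ideal.subspaceI)
      show "0 \<in> range ?h" by (rule range_eqI[of _ _ "\<lambda>_. 0"]) simp
    next
      fix p q assume "p \<in> range ?h" "q \<in> range ?h"
      then obtain c d where "p = ?h c" "q = ?h d" by blast
      then have "p + q = ?h (\<lambda>s. c s + d s)"
        by (simp add: sum.distrib distrib_right)
      then show "p + q \<in> range ?h" by (rule range_eqI[where f = ?h])
    next
      fix b p assume "p \<in> range ?h"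
      then obtain c where "p = ?h c" by blast
      then have "b * p = ?h (\<lambda>s. b * c s)"
        by (simp only: sum_distrib_left mult.assoc)
      then show "b * p \<in> range ?h" by (rule range_eqI[where f = ?h])
    qed
  qed
  with assms(2) show ?thesis by blast
qed

section \<open>Homogeneous components\<close>

text \<open>Degrees are integers because they arise as differences of shifts; a component of
  negative degree is zero.\<close>

definition hcomp :: "int \<Rightarrow> ('v, 'k::field) mpoly \<Rightarrow> ('v, 'k) mpoly" where
  "hcomp d p = Poly_Mapping.mapp (\<lambda>m c. c when int (monom_degree m) = d) p"

lemma lookup_hcomp:
  "Poly_Mapping.lookup (hcomp d p) m = (Poly_Mapping.lookup p m when int (monom_degree m) = d)"
  by (auto simp: hcomp_def lookup_mapp when_def in_keys_iff)

lemma hcomp_zero [simp]: "hcomp d 0 = 0"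
  by (rule poly_mapping_eqI) (simp add: lookup_hcomp)

lemma hcomp_add: "hcomp d (p + q) = hcomp d p + hcomp d q"
  by (rule poly_mapping_eqI) (simp add: lookup_hcomp lookup_add when_add_distrib)

lemma hcomp_sum: "hcomp d (sum f I) = (\<Sum>i\<in>I. hcomp d (f i))"
  by (induction I rule: infinite_finite_induct) (simp_all add: hcomp_add)

lemma homogeneous_hcomp: "homogeneous d (hcomp d p)"
  by (auto simp: homogeneous_def in_keys_iff lookup_hcomp when_def split: if_splits)

lemma hcomp_eq_self_iff: "hcomp d p = p \<longleftrightarrow> homogeneous d p"
  unfolding homogeneous_def poly_mapping_eq_iff fun_eq_iff lookup_hcomp
  by (auto simp: when_def in_keys_iff Ball_def)

lemma monom_degree_add: "monom_degree (k + l) = monom_degree k + monom_degree l"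
proof -
  have eq: "monom_degree m = (\<Sum>x\<in>Poly_Mapping.keys k \<union> Poly_Mapping.keys l. Poly_Mapping.lookup m x)"
    if "Poly_Mapping.keys m \<subseteq> Poly_Mapping.keys k \<union> Poly_Mapping.keys l" for m
    unfolding monom_degree_def using that by (intro sum.mono_neutral_left) (auto simp: in_keys_iff)
  show ?thesis
    by (subst (1 2 3) eq) (auto simp: keys_add_nat lookup_add sum.distrib)
qed

lemma homogeneous_mult: "homogeneous d p \<Longrightarrow> homogeneous e q \<Longrightarrow> homogeneous (d + e) (p * q)"
  unfolding homogeneous_def using keys_mult[of p q] by (auto 0 3 simp: monom_degree_add)

lemma homogeneous_sum: "(\<And>i. i \<in> I \<Longrightarrow> homogeneous d (f i)) \<Longrightarrow> homogeneous d (sum f I)"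
  by (simp add: hcomp_sum flip: hcomp_eq_self_iff)

lemma homogeneous_var: "homogeneous 1 (var x)"
  by (simp add: homogeneous_def var_def monom_degree_def)

lemma homogeneous_one: "homogeneous 0 1"
  by (simp add: homogeneous_def monom_degree_def)

lemma homogeneous_sqfree: "finite A \<Longrightarrow> homogeneous (int (card A)) (sqfree A)"
  by (simp add: sqfree_eq_single homogeneous_def monom_degree_def keys_sqfree_exp lookup_sqfree_exp)

text \<open>The rest \<open>p - hcomp d p\<close> has no term of degree \<open>d\<close>, hence its
  product with \<open>q\<close> has none of degree \<open>d + e\<close>.\<close>

lemma hcomp_mult_homogeneous:
  assumes "homogeneous e q"
  shows "hcomp (d + e) (q * p) = q * hcomp d p"
proof -
  have "hcomp (d + e) (q * (p - hcomp d p)) = 0"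
  proof (rule poly_mapping_eqI)
    fix m
    have "m \<notin> Poly_Mapping.keys (q * (p - hcomp d p))" if "int (monom_degree m) = d + e"
    proof
      assume "m \<in> Poly_Mapping.keys (q * (p - hcomp d p))"
      then obtain a b where ab: "m = a + b" "a \<in> Poly_Mapping.keys q"
          "b \<in> Poly_Mapping.keys (p - hcomp d p)"
        using keys_mult by blast
      with assms that have "int (monom_degree b) = d"
        by (auto simp: homogeneous_def monom_degree_add)
      with ab(3) show False
        by (simp add: in_keys_iff lookup_minus lookup_hcomp)
    qed
    then show "Poly_Mapping.lookup (hcomp (d + e) (q * (p - hcomp d p))) m = Poly_Mapping.lookup 0 m"
      by (auto simp: lookup_hcomp when_def in_keys_iff)
  qed
  moreover have "hcomp (d + e) (q * hcomp d p) = q * hcomp d p"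
    using homogeneous_mult[OF assms homogeneous_hcomp, of d p]
    by (simp add: hcomp_eq_self_iff add.commute)
  moreover have "q * p = q * (p - hcomp d p) + q * hcomp d p"
    by (simp add: algebra_simps)
  ultimately show ?thesis
    by (metis hcomp_add add_0)
qed

lemma monom_degree_eq_0_iff: "monom_degree m = 0 \<longleftrightarrow> m = 0"
  by (auto simp: monom_degree_def poly_mapping_eq_iff in_keys_iff fun_eq_iff)

lemma homogeneous_lookup_0: "homogeneous d p \<Longrightarrow> Poly_Mapping.lookup p 0 \<noteq> 0 \<Longrightarrow> d = 0"
  unfolding homogeneous_def lookup_not_eq_zero_eq_in_keys by (drule bspec) (auto simp: monom_degree_def)

lemma homogeneous_0_eq: "homogeneous 0 p \<Longrightarrow> p = Poly_Mapping.single 0 (Poly_Mapping.lookup p 0)"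
  by (rule poly_mapping_eqI)
    (auto simp: homogeneous_def in_keys_iff monom_degree_eq_0_iff lookup_single when_def)

text \<open>Taking the constant term is reduction modulo the irrelevant ideal, hence
  multiplicative.\<close>

lemma lookup_mult_0:
  fixes p q :: "('v, 'k::field) mpoly"
  shows "Poly_Mapping.lookup (p * q) 0 = Poly_Mapping.lookup p 0 * Poly_Mapping.lookup q 0"
proof -
  have "p * q - Poly_Mapping.single 0 (Poly_Mapping.lookup p 0 * Poly_Mapping.lookup q 0) =
      (p - Poly_Mapping.single 0 (Poly_Mapping.lookup p 0)) * q +
      (q - Poly_Mapping.single 0 (Poly_Mapping.lookup q 0)) * Poly_Mapping.single 0 (Poly_Mapping.lookup p 0)"
    by (simp add: algebra_simps mult_single)
  also have "\<dots> \<in> irrelevant_ideal"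
    unfolding irrelevant_ideal_def
    by (intro ideal.span_add ideal_gen_mult_right)
      (simp_all add: mem_irrelevant_ideal[unfolded irrelevant_ideal_def] lookup_minus)
  finally show ?thesis
    by (simp add: mem_irrelevant_ideal lookup_minus)
qed

section \<open>Graded matrices\<close>

lemma mult_mat_vec_nth:
  "A \<in> carrier_mat m n \<Longrightarrow> w \<in> carrier_vec n \<Longrightarrow> l < m \<Longrightarrow>
    (A *\<^sub>v w) $ l = (\<Sum>k<n. A $$ (l, k) * w $ k)"
  by (auto simp: scalar_prod_def row_def lessThan_atLeast0 intro!: sum.cong)

lemma mult_mat_vec_smult:
  fixes A :: "'a::comm_ring_1 mat"
  shows "A \<in> carrier_mat m n \<Longrightarrow> w \<in> carrier_vec n \<Longrightarrow> A *\<^sub>v (c \<cdot>\<^sub>v w) = c \<cdot>\<^sub>v (A *\<^sub>v w)"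
  by (intro eq_vecI) auto

lemma mult_mat_vec_zero:
  fixes A :: "'a::comm_ring_1 mat"
  shows "A \<in> carrier_mat m n \<Longrightarrow> A *\<^sub>v 0\<^sub>v n = 0\<^sub>v m"
  by (intro eq_vecI) auto

lemma mult_mat_vec_unit:
  fixes A :: "'a::comm_ring_1 mat"
  shows "A \<in> carrier_mat m n \<Longrightarrow> j < n \<Longrightarrow> A *\<^sub>v unit_vec n j = col A j"
  by (intro eq_vecI) auto

lemma graded_matD:
  assumes "graded_mat es ds A"
  shows "A \<in> carrier_mat (length es) (length ds)"
    and "l < length es \<Longrightarrow> k < length ds \<Longrightarrow> homogeneous (ds ! k - es ! l) (A $$ (l, k))"
  using assms by (auto simp: graded_mat_def)

lemma graded_mat_mult:
  assumes "graded_mat es ds A" "graded_mat ds fs B"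
  shows "graded_mat es fs (A * B)"
  unfolding graded_mat_def
proof (intro conjI allI impI)
  note A = graded_matD[OF assms(1)] and B = graded_matD[OF assms(2)]
  show "A * B \<in> carrier_mat (length es) (length fs)"
    using A(1) B(1) by simp
  fix l k assume lk: "l < length es" "k < length fs"
  have "homogeneous (fs ! k - es ! l) (A $$ (l, j) * B $$ (j, k))" if "j < length ds" for j
    using homogeneous_mult[OF A(2)[OF lk(1) that] B(2)[OF that lk(2)]] by simp
  then show "homogeneous (fs ! k - es ! l) ((A * B) $$ (l, k))"
    using A(1) B(1) lk by (auto simp: scalar_prod_def intro!: homogeneous_sum)
qed

text \<open>The part of degree \<open>d\<close> in the graded free module with shifts
  \<open>ds\<close>: since basis vector \<open>k\<close> has degree \<open>ds ! k\<close>, its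
  coefficient must have degree \<open>d - ds ! k\<close>.\<close>

definition hcomp_vec :: "int list \<Rightarrow> int \<Rightarrow> ('v, 'k::field) mpoly vec \<Rightarrow> ('v, 'k) mpoly vec" where
  "hcomp_vec ds d w = vec (length ds) (\<lambda>k. hcomp (d - ds ! k) (w $ k))"

lemma hcomp_vec_simps [simp]:
  "hcomp_vec ds d w \<in> carrier_vec (length ds)"
  "k < length ds \<Longrightarrow> hcomp_vec ds d w $ k = hcomp (d - ds ! k) (w $ k)"
  by (simp_all add: hcomp_vec_def)

lemma graded_mat_hcomp_vec:
  assumes "graded_mat es ds A" "w \<in> carrier_vec (length ds)"
  shows "A *\<^sub>v hcomp_vec ds d w = hcomp_vec es d (A *\<^sub>v w)"
proof (rule eq_vecI)
  note A = graded_matD[OF assms(1)]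
  show "dim_vec (A *\<^sub>v hcomp_vec ds d w) = dim_vec (hcomp_vec es d (A *\<^sub>v w))"
    using A(1) by (simp add: hcomp_vec_def)
  fix l assume "l < dim_vec (hcomp_vec es d (A *\<^sub>v w))"
  then have l: "l < length es"
    by (simp add: hcomp_vec_def)
  have "hcomp (d - es ! l) (A $$ (l, k) * w $ k) = A $$ (l, k) * hcomp (d - ds ! k) (w $ k)"
    if "k < length ds" for k
    using hcomp_mult_homogeneous[OF A(2)[OF l that], of "d - ds ! k"] by simp
  then show "(A *\<^sub>v hcomp_vec ds d w) $ l = hcomp_vec es d (A *\<^sub>v w) $ l"
    using l assms(2) by (simp add: mult_mat_vec_nth[OF A(1)] hcomp_sum)
qed

text \<open>Each column of \<open>A\<close> has a preimage under \<open>A'\<close>. The preimage may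
  be inhomogeneous, but the column is not, so the component in the degree of the column is a
  preimage as well. These components are the columns of \<open>B\<close>.\<close>

lemma graded_factor:
  assumes A: "graded_mat es ds A" and A': "graded_mat es ds' A'"
    and sub: "mat_image A \<subseteq> mat_image A'"
  shows "\<exists>B. graded_mat ds' ds B \<and> A = A' * B"
proof -
  note Ac = graded_matD(1)[OF A] and A'c = graded_matD(1)[OF A']
  have "\<exists>b. b \<in> carrier_vec (length ds') \<and> (\<forall>k<length ds'. homogeneous (ds ! j - ds' ! k) (b $ k)) \<and>
      A' *\<^sub>v b = col A j" if j: "j < length ds" for j
  proof -
    have "A *\<^sub>v unit_vec (length ds) j = col A j"
      using Ac j by (rule mult_mat_vec_unit)
    then have "col A j \<in> mat_image A"
      using Ac unfolding mat_image_def by (metis carrier_matD(2) image_eqI unit_vec_carrier)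
    with sub A'c obtain w where w: "w \<in> carrier_vec (length ds')" "A' *\<^sub>v w = col A j"
      unfolding mat_image_def by auto
    have "A' *\<^sub>v hcomp_vec ds' (ds ! j) w = hcomp_vec es (ds ! j) (col A j)"
      using graded_mat_hcomp_vec[OF A' w(1)] w(2) by simp
    also have "\<dots> = col A j"
      using graded_matD[OF A] j
      by (intro eq_vecI) (auto simp: hcomp_eq_self_iff hcomp_vec_def)
    finally show ?thesis
      by (intro exI[of _ "hcomp_vec ds' (ds ! j) w"]) (simp add: homogeneous_hcomp)
  qed
  then obtain b where b: "\<And>j. j < length ds \<Longrightarrow> b j \<in> carrier_vec (length ds') \<and>
      (\<forall>k<length ds'. homogeneous (ds ! j - ds' ! k) (b j $ k)) \<and> A' *\<^sub>v b j = col A j"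
    by metis
  define B where "B = mat (length ds') (length ds) (\<lambda>(k, j). b j $ k)"
  have "graded_mat ds' ds B"
    using b by (auto simp: graded_mat_def B_def)
  moreover have "A = A' * B"
  proof (rule eq_matI)
    fix l j assume lj: "l < dim_row (A' * B)" "j < dim_col (A' * B)"
    then have j: "j < length ds" and l: "l < length es"
      using A'c by (auto simp: B_def)
    have "col B j = b j"
      using b[OF j] j by (intro eq_vecI) (auto simp: B_def)
    then have "(A' * B) $$ (l, j) = (A' *\<^sub>v b j) $ l"
      using lj by simp
    also have "\<dots> = A $$ (l, j)"
      using b[OF j] j l Ac by simp
    finally show "A $$ (l, j) = (A' * B) $$ (l, j)" ..
  qed (use Ac A'c in \<open>auto simp: B_def\<close>)
  ultimately show ?thesis by blast
qed

section \<open>Ideals of leading coefficients and linear syzygies\<close>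

text \<open>
  If \<open>A\<close> is a row $(m_0, \dots, m_{b-1})$, this is the colon ideal $(m_0, \dots, m_{i-1}) : m_i$.
\<close>

definition lead_ideal :: "'a::comm_ring_1 mat \<Rightarrow> nat \<Rightarrow> 'a set" where
  "lead_ideal A i = {w $ i | w. w \<in> mat_kernel A \<and> (\<forall>k. i < k \<and> k < dim_col A \<longrightarrow> w $ k = 0)}"

lemma subspace_lead_ideal:
  assumes "i < dim_col A"
  shows "ideal.subspace (lead_ideal A i)"
proof (rule ideal.subspaceI)
  show "0 \<in> lead_ideal A i"
    using assms unfolding lead_ideal_def mat_kernel_def
    by (auto intro!: exI[of _ "0\<^sub>v (dim_col A)"])
next
  fix x y assume "x \<in> lead_ideal A i" "y \<in> lead_ideal A i"
  then obtain v w where vw: "v \<in> mat_kernel A" "\<forall>k. i < k \<and> k < dim_col A \<longrightarrow> v $ k = 0"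
      "w \<in> mat_kernel A" "\<forall>k. i < k \<and> k < dim_col A \<longrightarrow> w $ k = 0" "x = v $ i" "y = w $ i"
    by (auto simp: lead_ideal_def)
  moreover have "v + w \<in> mat_kernel A"
    using vw by (auto simp: mat_kernel_def mult_add_distrib_mat_vec[of _ "dim_row A" "dim_col A"])
  ultimately show "x + y \<in> lead_ideal A i"
    unfolding lead_ideal_def using assms by (auto simp: mat_kernel_def intro!: exI[of _ "v + w"])
next
  fix c x assume "x \<in> lead_ideal A i"
  then obtain v where v: "v \<in> mat_kernel A" "\<forall>k. i < k \<and> k < dim_col A \<longrightarrow> v $ k = 0" "x = v $ i"
    by (auto simp: lead_ideal_def)
  moreover have "c \<cdot>\<^sub>v v \<in> mat_kernel A"
    using v by (intro mat_kernel_smult[of _ "dim_row A" "dim_col A"]) auto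
  ultimately show "c * x \<in> lead_ideal A i"
    unfolding lead_ideal_def using assms by (auto simp: mat_kernel_def intro!: exI[of _ "c \<cdot>\<^sub>v v"])
qed

text \<open>The second conjunct is the condition of linear quotients, phrased for matrices instead
  of lists of monomials so that it can be passed on to syzygy modules.\<close>

definition linear_cover :: "int list \<Rightarrow> int \<Rightarrow> ('v, 'k::field) mpoly mat \<Rightarrow> bool" where
  "linear_cover es a A \<longleftrightarrow> graded_mat es (replicate (dim_col A) a) A \<and>
     (\<forall>i<dim_col A. \<exists>S. lead_ideal A i = ideal_gen (var ` S))"

lemma sum_fiber_distinct_list:
  assumes "distinct ps" "set ps = Sigma {..<m} S" "i < m"
  shows "(\<Sum>q | q < length ps \<and> fst (ps ! q) = i. f (snd (ps ! q))) = (\<Sum>s\<in>S i. f s)"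
proof (rule sum.reindex_bij_betw)
  show "bij_betw (\<lambda>q. snd (ps ! q)) {q. q < length ps \<and> fst (ps ! q) = i} (S i)"
    unfolding bij_betw_def
  proof
    show "inj_on (\<lambda>q. snd (ps ! q)) {q. q < length ps \<and> fst (ps ! q) = i}"
      using assms(1) by (intro inj_onI) (metis (mono_tags, lifting) mem_Collect_eq nth_eq_iff_index_eq prod_eqI)
    show "(\<lambda>q. snd (ps ! q)) ` {q. q < length ps \<and> fst (ps ! q) = i} = S i"
    proof safe
      fix q assume "q < length ps" "i = fst (ps ! q)"
      then show "snd (ps ! q) \<in> S (fst (ps ! q))"
        using nth_mem[of q ps] assms(2) by auto
    next
      fix s assume "s \<in> S i"
      then have "(i, s) \<in> set ps" using assms by simp
      then obtain q where "q < length ps" "ps ! q = (i, s)"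
        by (auto simp: in_set_conv_nth)
      then show "s \<in> (\<lambda>q. snd (ps ! q)) ` {q. q < length ps \<and> fst (ps ! q) = i}"
        by (intro image_eqI[of _ _ q]) auto
    qed
  qed
qed

text \<open>The inductive step of the resolution. For every position \<open>i\<close> and every
  variable generating the lead ideal there, a linear syzygy ending at \<open>i\<close> in that
  variable is chosen as a column of \<open>Z\<close>. Clearing last entries one position at a time
  shows that these columns generate all syzygies. The lead ideals of \<open>Z\<close> are again
  generated by variables, because ideals of variables are prime and the commutation of two variables
  supplies the relations needed.\<close>

lemma linear_cover_kernel:
  fixes A :: "('v::finite, 'k::field) mpoly mat"
  assumes cover: "linear_cover es a A"
  shows "\<exists>Z. linear_cover (replicate (dim_col A) a) (a + 1) Z \<and> dim_row Z = dim_col A \<and>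
    mat_image Z = mat_kernel A"
proof -
  define m where "m = dim_col A"
  let ?ds = "replicate m a"
  have gA: "graded_mat es ?ds A"
    using cover by (simp add: linear_cover_def m_def)
  then have Ac: "A \<in> carrier_mat (length es) m"
    by (auto dest: graded_matD)
  note ker = mat_kernel[OF Ac]
  from cover obtain S where S: "\<And>i. i < m \<Longrightarrow> lead_ideal A i = ideal_gen (var ` S i)"
    unfolding linear_cover_def m_def by metis
  define P where "P i s v \<longleftrightarrow> v \<in> mat_kernel A \<and> v $ i = var s \<and>
      (\<forall>k. i < k \<and> k < m \<longrightarrow> v $ k = 0) \<and> (\<forall>k<m. homogeneous 1 (v $ k))" for i s v
  have "\<exists>v. P i s v" if "i < m" "s \<in> S i" for i s
  proof -
    have "var s \<in> lead_ideal A i"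
      unfolding S[OF that(1)] using that(2) by (intro ideal.span_base imageI)
    then obtain w where w: "w \<in> mat_kernel A" "w $ i = var s" "\<And>k. i < k \<Longrightarrow> k < m \<Longrightarrow> w $ k = 0"
      by (auto simp: lead_ideal_def m_def)
    \<comment> \<open>Passing to the component of degree \<open>a + 1\<close> keeps \<open>w\<close>
      a syzygy and keeps its last entry \<open>var s\<close>, which is linear already, while making
      all other entries linear.\<close>
    let ?z = "hcomp_vec ?ds (a + 1) w"
    have "A *\<^sub>v ?z = 0\<^sub>v (length es)"
      using w(1) unfolding ker
      by (subst graded_mat_hcomp_vec[OF gA]) (auto simp: hcomp_vec_def)
    then have "?z \<in> mat_kernel A"
      unfolding ker using hcomp_vec_simps(1)[of ?ds "a + 1" w] by simp
    moreover have "?z $ i = var s"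
      using w(2) that(1) homogeneous_var[of s] by (simp add: hcomp_eq_self_iff)
    ultimately show ?thesis
      unfolding P_def using w(3) by (intro exI[of _ ?z]) (auto simp: homogeneous_hcomp)
  qed
  then have "P i s (SOME v. P i s v)" if "i < m" "s \<in> S i" for i s
    using that by (blast intro: someI_ex)
  then obtain z where "P i s (z i s)" if "i < m" "s \<in> S i" for i s
    by (rule that)
  then have z: "\<And>i s. i < m \<Longrightarrow> s \<in> S i \<Longrightarrow> z i s \<in> mat_kernel A"
      "\<And>i s. i < m \<Longrightarrow> s \<in> S i \<Longrightarrow> z i s $ i = var s"
      "\<And>i s k. i < m \<Longrightarrow> s \<in> S i \<Longrightarrow> i < k \<Longrightarrow> k < m \<Longrightarrow> z i s $ k = 0"
      "\<And>i s k. i < m \<Longrightarrow> s \<in> S i \<Longrightarrow> k < m \<Longrightarrow> homogeneous 1 (z i s $ k)"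
    by (simp_all add: P_def)
  obtain ps0 where ps0: "set ps0 = Sigma {..<m} S" "distinct ps0"
    using finite_distinct_list[of "Sigma {..<m} S"] by auto
  \<comment> \<open>Sorting orders the columns of \<open>Z\<close> by the position
    \<open>f q\<close> of their last entry, so columns that end further down come later.\<close>
  define ps where "ps = sort_key fst ps0"
  have ps: "set ps = Sigma {..<m} S" "distinct ps" "sorted (map fst ps)"
    by (simp_all add: ps_def ps0)
  define n where "n = length ps"
  define f where "f q = fst (ps ! q)" for q
  define x where "x q = snd (ps ! q)" for q
  have f_less: "f q < m" and x_in: "x q \<in> S (f q)" if "q < n" for q
  proof -
    have "ps ! q \<in> Sigma {..<m} S"
      using nth_mem[of q ps] that unfolding n_def ps(1) by blast
    then show "f q < m" "x q \<in> S (f q)"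
      by (cases "ps ! q"; simp add: f_def x_def)+
  qed
  have f_mono: "f q \<le> f p" if "q \<le> p" "p < n" for p q
    using sorted_nth_mono[OF ps(3) that(1)] that by (simp add: f_def n_def)
  have fx_inj: "q = p" if "f q = f p" "x q = x p" "q < n" "p < n" for p q
    using that ps(2) by (metis f_def n_def nth_eq_iff_index_eq prod_eqI x_def)
  define Z where "Z = mat m n (\<lambda>(k, q). z (f q) (x q) $ k)"
  have Zc: "Z \<in> carrier_mat m n"
    by (simp add: Z_def)
  have colZ: "col Z q = z (f q) (x q)" if "q < n" for q
    using z(1)[OF f_less[OF that] x_in[OF that]] that unfolding ker Z_def
    by (intro eq_vecI) auto
  have AZ: "A * Z = 0\<^sub>m (length es) n"
  proof (rule eq_matI)
    fix l q assume lq: "l < dim_row (0\<^sub>m (length es) n :: ('v, 'k) mpoly mat)"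
      "q < dim_col (0\<^sub>m (length es) n :: ('v, 'k) mpoly mat)"
    then have "(A * Z) $$ (l, q) = (A *\<^sub>v z (f q) (x q)) $ l"
      using Ac Zc by (simp add: colZ)
    also have "\<dots> = 0"
      using z(1)[OF f_less x_in] lq by (simp add: ker)
    finally show "(A * Z) $$ (l, q) = 0\<^sub>m (length es) n $$ (l, q)"
      using lq by simp
  qed (use Ac Zc in auto)
  have Zker: "Z *\<^sub>v w \<in> mat_kernel A" if "w \<in> carrier_vec n" for w
  proof -
    have "A *\<^sub>v (Z *\<^sub>v w) = 0\<^sub>m (length es) n *\<^sub>v w"
      using assoc_mult_mat_vec[OF Ac Zc that] AZ by simp
    also have "\<dots> = 0\<^sub>v (length es)"
      using that by (intro eq_vecI) auto
    finally show ?thesis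
      using Zc that by (simp add: ker)
  qed
  \<comment> \<open>This is an echelon shape: column \<open>q\<close> has the variable
    \<open>x q\<close> in row \<open>f q\<close> and zeros below it.\<close>
  have Z_entry: "Z $$ (k, q) = (if k = f q then var (x q) else 0)" if "q < n" "k < m" "f q \<le> k" for k q
    using that z(2,3)[OF f_less x_in] by (auto simp: Z_def)
  have Z_vanish: "(Z *\<^sub>v w) $ k = 0"
    if "w \<in> carrier_vec n" "k < m" "\<And>q. q < n \<Longrightarrow> k \<le> f q \<Longrightarrow> w $ q = 0" for w k
  proof -
    have "Z $$ (k, q) * w $ q = 0" if "q < n" for q
      using Z_entry[of q k] \<open>k < m\<close> that(1) that \<open>\<And>q. q < n \<Longrightarrow> k \<le> f q \<Longrightarrow> w $ q = 0\<close>[of q]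
      by (cases "k \<le> f q") auto
    then show ?thesis
      by (simp add: mult_mat_vec_nth[OF Zc that(1,2)])
  qed
  have Z_lead: "(Z *\<^sub>v w) $ i = (\<Sum>q | q < n \<and> f q = i. var (x q) * w $ q)"
    if "w \<in> carrier_vec n" "i < m" "\<And>q. q < n \<Longrightarrow> i < f q \<Longrightarrow> w $ q = 0" for w i
  proof -
    have "(Z *\<^sub>v w) $ i = (\<Sum>q<n. Z $$ (i, q) * w $ q)"
      by (rule mult_mat_vec_nth[OF Zc that(1,2)])
    also have "\<dots> = (\<Sum>q | q < n \<and> f q = i. Z $$ (i, q) * w $ q)"
    proof (rule sum.mono_neutral_right)
      show "\<forall>q\<in>{..<n} - {q. q < n \<and> f q = i}. Z $$ (i, q) * w $ q = 0"
      proof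
        fix q assume q: "q \<in> {..<n} - {q. q < n \<and> f q = i}"
        then consider "f q < i" | "i < f q" by fastforce
        then show "Z $$ (i, q) * w $ q = 0"
          using that q by cases (auto simp: Z_entry)
      qed
    qed auto
    also have "\<dots> = (\<Sum>q | q < n \<and> f q = i. var (x q) * w $ q)"
      using that(2) by (intro sum.cong) (auto simp: Z_entry)
    finally show ?thesis .
  qed
  \<comment> \<open>Division by the columns of \<open>Z\<close>, by induction on a bound
    \<open>i\<close> for the support of \<open>w\<close>. The bound on the support of the quotient
    \<open>v\<close> is needed later, when commutation relations are corrected without disturbing
    their last entry.\<close>
  have surj: "\<exists>v \<in> carrier_vec n. Z *\<^sub>v v = w \<and> (\<forall>q<n. i \<le> f q \<longrightarrow> v $ q = 0)"
    if "i \<le> m" "w \<in> mat_kernel A" "\<And>k. i \<le> k \<Longrightarrow> k < m \<Longrightarrow> w $ k = 0" for i w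
    using that
  proof (induction i arbitrary: w)
    case 0
    then have "w = 0\<^sub>v m"
      by (auto simp: ker)
    then show ?case
      using Zc by (intro bexI[of _ "0\<^sub>v n"]) auto
  next
    case (Suc i)
    then have i: "i < m" by simp
    have "w $ i \<in> lead_ideal A i"
      using Suc.prems unfolding lead_ideal_def m_def[symmetric] by force
    then obtain c where c: "w $ i = (\<Sum>s\<in>S i. c s * var s)"
      using mem_ideal_gen_image[of "S i" "w $ i" var] by (auto simp: S[OF i])
    \<comment> \<open>The coefficients \<open>c\<close> of the last entry \<open>w $ i\<close> are
      distributed over the columns ending at \<open>i\<close>; subtracting
      \<open>Z *\<^sub>v u\<close> then clears that entry.\<close>
    define u where "u = vec n (\<lambda>q. if f q = i then c (x q) else 0)"
    have uc: "u \<in> carrier_vec n" by (simp add: u_def)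
    have wc: "w \<in> carrier_vec m" using Suc.prems(2) by (simp add: ker)
    have "(Z *\<^sub>v u) $ i = (\<Sum>q | q < n \<and> f q = i. var (x q) * c (x q))"
      using i uc by (subst Z_lead) (auto simp: u_def intro!: sum.cong)
    also have "\<dots> = w $ i"
      unfolding c using sum_fiber_distinct_list[OF ps(2,1) i, of "\<lambda>s. var s * c s"]
      by (simp add: f_def x_def n_def mult.commute)
    finally have lead: "(Z *\<^sub>v u) $ i = w $ i" .
    have "w - Z *\<^sub>v u \<in> mat_kernel A"
      using Zker[OF uc] Suc.prems(2) Ac unfolding ker
      by (auto simp: mult_minus_distrib_mat_vec[OF Ac])
    moreover have "(w - Z *\<^sub>v u) $ k = 0" if "i \<le> k" "k < m" for k
    proof (cases "k = i")
      case False
      then have "(Z *\<^sub>v u) $ k = 0"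
        using that by (intro Z_vanish[OF uc]) (auto simp: u_def)
      then show ?thesis
        using Suc.prems(3)[of k] False that Zc wc by simp
    qed (use lead i Zc wc in auto)
    ultimately obtain v where v: "v \<in> carrier_vec n" "Z *\<^sub>v v = w - Z *\<^sub>v u"
        "\<forall>q<n. i \<le> f q \<longrightarrow> v $ q = 0"
      using Suc.IH[of "w - Z *\<^sub>v u"] i by auto
    have "Z *\<^sub>v (v + u) = w"
      using v(2) wc Zc by (auto simp: mult_add_distrib_mat_vec[OF Zc v(1) uc])
    moreover have "(v + u) $ q = 0" if "q < n" "Suc i \<le> f q" for q
      using that v(1,3) uc by (auto simp: u_def)
    ultimately show ?case
      using v(1) uc by (intro bexI[of _ "v + u"]) auto
  qed
  have image: "mat_image Z = mat_kernel A"
  proof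
    show "mat_image Z \<subseteq> mat_kernel A"
      using Zker Zc by (auto simp: mat_image_def)
    show "mat_kernel A \<subseteq> mat_image Z"
      using surj[of m] Zc by (fastforce simp: mat_image_def)
  qed
  \<comment> \<open>Only earlier columns with the same last position matter. A relation ending at
    \<open>p\<close>, read in row \<open>f p\<close>, puts the product of its last entry and
    \<open>var (x p)\<close> into the ideal of the earlier variables.\<close>
  have lead: "lead_ideal Z p = ideal_gen (var ` {x q | q. q < p \<and> f q = f p})" (is "_ = ideal_gen (var ` ?T)")
    if p: "p < n" for p
  proof
    note fp = f_less[OF p]
    show "lead_ideal Z p \<subseteq> ideal_gen (var ` ?T)"
    proof
      fix y assume "y \<in> lead_ideal Z p"
      then obtain w where w: "w \<in> carrier_vec n" "Z *\<^sub>v w = 0\<^sub>v m"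
          "\<And>q. p < q \<Longrightarrow> q < n \<Longrightarrow> w $ q = 0" "y = w $ p"
        using Zc by (auto simp: lead_ideal_def mat_kernel)
      have "w $ q = 0" if "q < n" "f p < f q" for q
        using w(3)[of q] f_mono[of q p] that p by (cases "p < q") auto
      then have "0 = (\<Sum>q | q < n \<and> f q = f p. var (x q) * w $ q)"
        using Z_lead[OF w(1) fp] w(2) fp by simp
      also have "\<dots> = var (x p) * w $ p + (\<Sum>q\<in>{q. q < n \<and> f q = f p} - {p}. var (x q) * w $ q)"
        using p by (intro sum.remove) auto
      finally have "y * var (x p) = - (\<Sum>q\<in>{q. q < n \<and> f q = f p} - {p}. var (x q) * w $ q)"
        by (simp add: w(4) eq_neg_iff_add_eq_0 mult.commute)
      also have "\<dots> \<in> ideal_gen (var ` ?T)"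
      proof (intro ideal.span_neg ideal.span_sum)
        fix q assume q: "q \<in> {q. q < n \<and> f q = f p} - {p}"
        show "var (x q) * w $ q \<in> ideal_gen (var ` ?T)"
        proof (cases "q < p")
          case True
          with q show ?thesis
            by (intro ideal_gen_mult_right ideal.span_base) auto
        next
          case False
          with q have "w $ q = 0" by (intro w(3)) auto
          then show ?thesis by (simp add: ideal.span_zero)
        qed
      qed
      \<comment> \<open>The variable \<open>x p\<close> is not among the earlier ones, since
        position and variable together determine the column.\<close>
      finally show "y \<in> ideal_gen (var ` ?T)"
        by (rule mult_var_mem_var_ideal) (use fx_inj p in fastforce)
    qed
    show "ideal_gen (var ` ?T) \<subseteq> lead_ideal Z p"
    proof (rule ideal.span_minimal)
      show "ideal.subspace (lead_ideal Z p)"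
        using p Zc by (intro subspace_lead_ideal) simp
      show "var ` ?T \<subseteq> lead_ideal Z p"
      proof safe
        fix q assume q: "q < p" "f q = f p"
        with p have qn: "q < n" by simp
        \<comment> \<open>The commutation relation of \<open>x q\<close> and \<open>x p\<close>. Its
          image under \<open>Z\<close> vanishes from row \<open>f p\<close> on, so
          \<open>surj\<close> writes this image as \<open>Z *\<^sub>v v\<close> with
          \<open>v\<close> supported on columns ending before \<open>f p\<close>. Hence
          \<open>e - v\<close> is a syzygy of \<open>Z\<close> whose last entry is still
          \<open>var (x q)\<close> at \<open>p\<close>.\<close>
        define e where "e = var (x q) \<cdot>\<^sub>v unit_vec n p - (var (x p) :: ('v, 'k) mpoly) \<cdot>\<^sub>v unit_vec n q"
        have ec: "e \<in> carrier_vec n" by (simp add: e_def)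
        have "(Z *\<^sub>v e) $ k = 0" if "f p \<le> k" "k < m" for k
          using that p qn q Zc
          by (simp add: e_def mult_minus_distrib_mat_vec[OF Zc] mult_mat_vec_smult[OF Zc]
              mult_mat_vec_unit[OF Zc] Z_entry mult.commute)
        then obtain v where v: "v \<in> carrier_vec n" "Z *\<^sub>v v = Z *\<^sub>v e" "\<forall>q<n. f p \<le> f q \<longrightarrow> v $ q = 0"
          using surj[of "f p" "Z *\<^sub>v e"] Zker[OF ec] fp by auto
        have "e - v \<in> mat_kernel Z"
          using v(1,2) ec Zc by (simp add: mat_kernel[OF Zc] mult_minus_distrib_mat_vec[OF Zc])
        moreover have "(e - v) $ p = var (x q)"
          using v p q qn ec by (simp add: e_def)
        moreover have "(e - v) $ r = 0" if "p < r" "r < n" for r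
          using v p q qn ec that f_mono[of p r] by (simp add: e_def)
        ultimately show "var (x q) \<in> lead_ideal Z p"
          unfolding lead_ideal_def using Zc by (auto intro!: exI[of _ "e - v"])
      qed
    qed
  qed
  have "graded_mat ?ds (replicate n (a + 1)) Z"
    using Zc z(4) f_less x_in by (auto simp: graded_mat_def Z_def)
  then have "linear_cover ?ds (a + 1) Z"
    unfolding linear_cover_def using lead Zc by auto
  then show ?thesis
    using image Zc by (auto simp: m_def)
qed

section \<open>Minimal covers and their comparison\<close>

lemma homogeneous_imp_irrelevant: "homogeneous d p \<Longrightarrow> d \<noteq> 0 \<Longrightarrow> p \<in> irrelevant_ideal"
  using homogeneous_lookup_0 by (auto simp: mem_irrelevant_ideal)

lemma mat_image_irrelevant:
  assumes "A \<in> carrier_mat m n" "elements_mat A \<subseteq> irrelevant_ideal" "v \<in> mat_image A" "k < m"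
  shows "v $ k \<in> irrelevant_ideal"
proof -
  from assms obtain w where w: "w \<in> carrier_vec n" "v = A *\<^sub>v w"
    by (auto simp: mat_image_def)
  have "A $$ (k, q) * w $ q \<in> irrelevant_ideal" if "q < n" for q
    using assms(1,2,4) that unfolding irrelevant_ideal_def
    by (intro ideal_gen_mult_right) auto
  then show ?thesis
    unfolding w(2) mult_mat_vec_nth[OF assms(1) w(1) assms(4)]
    unfolding irrelevant_ideal_def by (auto intro!: ideal.span_sum)
qed

lemma linear_cover_elements:
  assumes "linear_cover es a A" "\<forall>e\<in>set es. e < a"
  shows "elements_mat A \<subseteq> irrelevant_ideal"
proof
  fix p assume "p \<in> elements_mat A"
  then obtain l k where lk: "l < dim_row A" "k < dim_col A" "p = A $$ (l, k)"
    by blast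
  have g: "graded_mat es (replicate (dim_col A) a) A"
    using assms(1) by (simp add: linear_cover_def)
  have l: "l < length es"
    using graded_matD(1)[OF g] lk(1) by (metis carrier_matD(1))
  have "homogeneous (a - es ! l) p"
    using graded_matD(2)[OF g l, of k] lk by simp
  moreover have "es ! l < a"
    using assms(2) l by simp
  ultimately show "p \<in> irrelevant_ideal"
    by (intro homogeneous_imp_irrelevant[of "a - es ! l"]) simp_all
qed

text \<open>The columns of a linear cover are minimal generators: their syzygies are generated by
  syzygies whose entries are linear forms.\<close>

lemma linear_cover_kernel_irrelevant:
  fixes A :: "('v::finite, 'k::field) mpoly mat"
  assumes "linear_cover es a A" "w \<in> mat_kernel A" "k < dim_col A"
  shows "w $ k \<in> irrelevant_ideal"
proof -
  obtain Z where Z: "linear_cover (replicate (dim_col A) a) (a + 1) Z" "dim_row Z = dim_col A"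
      "mat_image Z = mat_kernel A"
    using linear_cover_kernel[OF assms(1)] by blast
  have "elements_mat Z \<subseteq> irrelevant_ideal"
    by (rule linear_cover_elements[OF Z(1)]) auto
  then show ?thesis
    using mat_image_irrelevant[of Z "dim_row Z" "dim_col Z" w k] Z(2,3) assms(2,3) by auto
qed

text \<open>The columns of \<open>M\<close> minus the identity are syzygies of \<open>A\<close>.
  When all syzygies have entries in the irrelevant ideal, \<open>M\<close> is therefore the identity
  modulo that ideal.\<close>

lemma lookup_0_fixing_mat:
  assumes A: "A \<in> carrier_mat m n" and M: "M \<in> carrier_mat n n" and AM: "A * M = A"
    and ker: "\<And>w k. w \<in> mat_kernel A \<Longrightarrow> k < n \<Longrightarrow> w $ k \<in> irrelevant_ideal"
    and l: "l < n" and k: "k < n"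
  shows "Poly_Mapping.lookup (M $$ (l, k)) 0 = (if l = k then 1 else 0)"
proof -
  have "A *\<^sub>v col M k = col (A * M) k"
    by (rule col_mult2[OF A M k, symmetric])
  then have "A *\<^sub>v (col M k - unit_vec n k) = 0\<^sub>v m"
    using A M k by (simp add: mult_minus_distrib_mat_vec[OF A] mult_mat_vec_unit[OF A] AM)
  then have "col M k - unit_vec n k \<in> mat_kernel A"
    using M by (auto simp: mat_kernel[OF A] intro!: minus_carrier_vec)
  then have "(col M k - unit_vec n k) $ l \<in> irrelevant_ideal"
    using l by (rule ker)
  then show ?thesis
    using M l k by (auto simp: mem_irrelevant_ideal lookup_minus split: if_splits)
qed

text \<open>With all shifts equal, the entries of \<open>M\<close> are scalars, so congruence to the
  identity modulo the irrelevant ideal is equality.\<close>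

lemma graded_fixing_mat_eq_one:
  assumes A: "A \<in> carrier_mat m n" and M: "graded_mat (replicate n a) (replicate n a) M"
    and AM: "A * M = A"
    and ker: "\<And>w k. w \<in> mat_kernel A \<Longrightarrow> k < n \<Longrightarrow> w $ k \<in> irrelevant_ideal"
  shows "M = 1\<^sub>m n"
proof (rule eq_matI)
  note gM = graded_matD[OF M]
  have Mc: "M \<in> carrier_mat n n" using gM(1) by simp
  fix l k assume "l < dim_row (1\<^sub>m n :: ('a, 'b) mpoly mat)" "k < dim_col (1\<^sub>m n :: ('a, 'b) mpoly mat)"
  then have lk: "l < n" "k < n" by auto
  have "homogeneous 0 (M $$ (l, k))"
    using gM(2)[of l k] lk by simp
  from homogeneous_0_eq[OF this] show "M $$ (l, k) = 1\<^sub>m n $$ (l, k)"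
    using lk by (simp add: lookup_0_fixing_mat[OF A Mc AM ker lk])
qed (use graded_matD(1)[OF M] in auto)

text \<open>Assumption \<open>ker'\<close> expresses that the columns of \<open>A'\<close> are
  minimal generators. Factoring \<open>A\<close> and \<open>A'\<close> through each other gives
  \<open>B\<close> and \<open>C\<close>, which turn out to be mutually inverse; then
  \<open>B\<close> carries the syzygies of \<open>A\<close> to those of \<open>A'\<close> and the
  linear cover \<open>Z\<close> to \<open>B * Z\<close>.\<close>

lemma linear_cover_transport:
  fixes A :: "('v::finite, 'k::field) mpoly mat"
  assumes cover: "linear_cover es a A" and A': "graded_mat es ds A'"
    and im: "mat_image A' = mat_image A"
    and ker': "\<And>w k. w \<in> mat_kernel A' \<Longrightarrow> k < length ds \<Longrightarrow> w $ k \<in> irrelevant_ideal"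
  shows "\<exists>Z. ds = replicate (length ds) a \<and> linear_cover ds (a + 1) Z \<and> mat_image Z = mat_kernel A'"
proof -
  define m where "m = dim_col A"
  define n where "n = length ds"
  have A: "graded_mat es (replicate m a) A"
    using cover by (simp add: linear_cover_def m_def)
  obtain B where B: "graded_mat ds (replicate m a) B" "A = A' * B"
    using graded_factor[OF A A'] im by auto
  obtain C where C: "graded_mat (replicate m a) ds C" "A' = A * C"
    using graded_factor[OF A' A] im by auto
  have Ac: "A \<in> carrier_mat (length es) m" and A'c: "A' \<in> carrier_mat (length es) n"
    and Bc: "B \<in> carrier_mat n m" and Cc: "C \<in> carrier_mat m n"
    using graded_matD(1)[OF A] graded_matD(1)[OF A'] graded_matD(1)[OF B(1)] graded_matD(1)[OF C(1)]
    by (simp_all add: n_def)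
  have A'BC: "A' * (B * C) = A'"
    using assoc_mult_mat[OF A'c Bc Cc] by (simp only: B(2)[symmetric] C(2)[symmetric])
  have ACB: "A * (C * B) = A"
    using assoc_mult_mat[OF Ac Cc Bc] by (simp only: B(2)[symmetric] C(2)[symmetric])
  have BCc: "B * C \<in> carrier_mat n n" using Bc Cc by simp
  have ker'': "\<And>w k. w \<in> mat_kernel A' \<Longrightarrow> k < n \<Longrightarrow> w $ k \<in> irrelevant_ideal"
    using ker' by (simp add: n_def)
  \<comment> \<open>The diagonal entry of \<open>B * C\<close> has constant term 1, so some entry in
    row \<open>k\<close> of \<open>B\<close> has a nonzero constant term and its degree
    \<open>a - ds ! k\<close> is 0.\<close>
  have "ds ! k = a" if k: "k < n" for k
  proof -
    have "(\<Sum>j<m. Poly_Mapping.lookup (B $$ (k, j)) 0 * Poly_Mapping.lookup (C $$ (j, k)) 0) =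
        Poly_Mapping.lookup ((B * C) $$ (k, k)) 0"
      using Bc Cc k by (simp add: scalar_prod_def lookup_sum lookup_mult_0 lessThan_atLeast0)
    also have "\<dots> = 1"
      using lookup_0_fixing_mat[OF A'c BCc A'BC ker'' k k] by simp
    finally obtain j where "j < m" "Poly_Mapping.lookup (B $$ (k, j)) 0 \<noteq> 0"
      by (metis (no_types, lifting) lessThan_iff mult_zero_left sum.neutral zero_neq_one)
    then show "ds ! k = a"
      using homogeneous_lookup_0[of "a - ds ! k" "B $$ (k, j)"] graded_matD(2)[OF B(1), of k j] k
      by (simp add: n_def)
  qed
  then have ds: "ds = replicate n a"
    by (intro nth_equalityI) (simp_all add: n_def)
  have BC: "B * C = 1\<^sub>m n"
    using graded_mat_mult[OF B(1) C(1)] ds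
    by (intro graded_fixing_mat_eq_one[OF A'c _ A'BC ker'']) simp_all
  have CB: "C * B = 1\<^sub>m m"
    using graded_mat_mult[OF C(1) B(1)] linear_cover_kernel_irrelevant[OF cover]
    by (intro graded_fixing_mat_eq_one[OF Ac _ ACB]) (simp_all add: m_def)
  obtain Z where Z: "linear_cover (replicate m a) (a + 1) Z" "dim_row Z = m" "mat_image Z = mat_kernel A"
    using linear_cover_kernel[OF cover] by (auto simp: m_def)
  define p where "p = dim_col Z"
  have Zc: "Z \<in> carrier_mat m p" using Z(2) by (auto simp: p_def)
  have BZc: "B * Z \<in> carrier_mat n p" using Bc Zc by simp
  have BZ: "(B * Z) *\<^sub>v v = B *\<^sub>v (Z *\<^sub>v v)" if "v \<in> carrier_vec p" for v
    by (rule assoc_mult_mat_vec[OF Bc Zc that])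
  have CBv: "C *\<^sub>v (B *\<^sub>v v) = v" if "v \<in> carrier_vec m" for v
    using assoc_mult_mat_vec[OF Cc Bc that] CB that by simp
  have BCv: "B *\<^sub>v (C *\<^sub>v v) = v" if "v \<in> carrier_vec n" for v
    using assoc_mult_mat_vec[OF Bc Cc that] BC that by simp
  \<comment> \<open>Lead ideals depend only on the kernel and the number of columns, and composing
    with the injective map \<open>B\<close> changes neither.\<close>
  have "mat_kernel (B * Z) = mat_kernel Z"
  proof -
    have "B *\<^sub>v (Z *\<^sub>v v) = 0\<^sub>v n \<longleftrightarrow> Z *\<^sub>v v = 0\<^sub>v m" if v: "v \<in> carrier_vec p" for v
    proof
      assume "B *\<^sub>v (Z *\<^sub>v v) = 0\<^sub>v n"
      then have "C *\<^sub>v 0\<^sub>v n = Z *\<^sub>v v"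
        using CBv[of "Z *\<^sub>v v"] Zc v by auto
      then show "Z *\<^sub>v v = 0\<^sub>v m"
        by (simp add: mult_mat_vec_zero[OF Cc])
    qed (simp add: mult_mat_vec_zero[OF Bc])
    then show ?thesis
      using BZ by (auto simp: mat_kernel[OF BZc] mat_kernel[OF Zc] mult_mat_vec_zero[OF Bc])
  qed
  then have lead: "lead_ideal (B * Z) i = lead_ideal Z i" for i
    unfolding lead_ideal_def using Zc by simp
  have "graded_mat ds (replicate p (a + 1)) (B * Z)"
    using graded_mat_mult[OF B(1)] Z(1) by (simp add: linear_cover_def p_def)
  then have "linear_cover ds (a + 1) (B * Z)"
    using Z(1) Zc lead by (simp add: linear_cover_def)
  moreover have "mat_image (B * Z) = mat_kernel A'"
  proof
    show "mat_image (B * Z) \<subseteq> mat_kernel A'"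
    proof
      fix y assume "y \<in> mat_image (B * Z)"
      then obtain v where v: "v \<in> carrier_vec p" "y = B *\<^sub>v (Z *\<^sub>v v)"
        using BZc BZ by (auto simp: mat_image_def)
      then have "Z *\<^sub>v v \<in> mat_kernel A"
        using Z(3) Zc by (auto simp: mat_image_def)
      then have "A' *\<^sub>v y = 0\<^sub>v (length es)"
        using assoc_mult_mat_vec[OF A'c Bc, of "Z *\<^sub>v v"] B(2)[symmetric] v by (simp add: mat_kernel[OF Ac])
      then show "y \<in> mat_kernel A'"
        using v Bc Zc by (auto simp: mat_kernel[OF A'c])
    qed
    show "mat_kernel A' \<subseteq> mat_image (B * Z)"
    proof
      fix y assume "y \<in> mat_kernel A'"
      then have y: "y \<in> carrier_vec n" "A' *\<^sub>v y = 0\<^sub>v (length es)"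
        by (simp_all add: mat_kernel[OF A'c])
      then have "C *\<^sub>v y \<in> mat_kernel A"
        using assoc_mult_mat_vec[OF Ac Cc y(1)] C(2)[symmetric] Cc by (simp add: mat_kernel[OF Ac])
      then obtain v where "v \<in> carrier_vec p" "C *\<^sub>v y = Z *\<^sub>v v"
        using Z(3) Zc by (auto simp: mat_image_def)
      then show "y \<in> mat_image (B * Z)"
        using BZc BZ BCv[OF y(1)] by (auto simp: mat_image_def intro!: image_eqI[of _ _ v])
    qed
  qed
  ultimately show ?thesis
    using ds unfolding n_def by blast
qed

section \<open>Ideals with a linear resolution\<close>

lemma scalar_prod_1: "v \<in> carrier_vec 1 \<Longrightarrow> u \<bullet> v = u $ 0 * v $ 0"
  by (simp add: scalar_prod_def)

text \<open>Iterating \<open>linear_cover_kernel\<close> constructs a resolution. Its existence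
  makes the choice in \<open>minimal_shifts\<close> meaningful.\<close>

lemma exists_minimal_graded_free_resolution:
  fixes A :: "('v::finite, 'k::field) mpoly mat"
  assumes cover: "linear_cover [0] a A" and im: "mat_image A = {v \<in> carrier_vec 1. v $ 0 \<in> I}"
    and a: "0 < a" and I: "0 \<in> I"
  shows "\<exists>d g \<phi>. minimal_graded_free_resolution I d g \<phi>"
proof -
  \<comment> \<open>A state consists of the shifts of the target module and the matrix into it. The
    bound on the shifts yields minimality, and the last conjunct pins the start of the chosen
    sequence.\<close>
  define P where "P n st \<longleftrightarrow> linear_cover (fst st) (a + int n) (snd st) \<and>
      (\<forall>e\<in>set (fst st). e < a + int n) \<and> (n = 0 \<longrightarrow> st = ([0], A))"
    for n and st :: "int list \<times> ('v, 'k) mpoly mat"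
  define Q where "Q n st st' \<longleftrightarrow> fst st' = replicate (dim_col (snd st)) (a + int n) \<and>
      mat_image (snd st') = mat_kernel (snd st)" for n and st st' :: "int list \<times> ('v, 'k) mpoly mat"
  have "\<exists>st. \<forall>n. P n (st n) \<and> Q n (st n) (st (Suc n))"
  proof (rule dependent_nat_choice)
    show "\<exists>st. P 0 st"
      using cover a by (intro exI[of _ "([0], A)"]) (simp add: P_def)
  next
    fix st n assume "P n st"
    then have "linear_cover (fst st) (a + int n) (snd st)"
      by (simp add: P_def)
    then obtain Z where "linear_cover (replicate (dim_col (snd st)) (a + int n)) (a + int n + 1) Z"
        "mat_image Z = mat_kernel (snd st)"
      using linear_cover_kernel by blast
    then show "\<exists>st'. P (Suc n) st' \<and> Q n st st'"
      by (intro exI[of _ "(replicate (dim_col (snd st)) (a + int n), Z)"])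
        (simp add: P_def Q_def add.assoc add.commute[of 1])
  qed
  then obtain st where P: "\<And>n. P n (st n)" and Q: "\<And>n. Q n (st n) (st (Suc n))"
    by blast
  have st0: "st 0 = ([0], A)"
    using P[of 0] by (simp add: P_def)
  let ?d = "\<lambda>i. fst (st i)" and ?\<phi> = "\<lambda>i. snd (st i)" and ?g = "vec 1 (\<lambda>_. 1) :: ('v, 'k) mpoly vec"
  have "minimal_graded_free_resolution I ?d ?g ?\<phi>"
    unfolding minimal_graded_free_resolution_def
  proof (intro conjI allI impI)
    show "?g \<in> carrier_vec (length (?d 0))"
      by (simp add: st0)
    show "homogeneous (?d 0 ! k) (?g $ k)" if "k < length (?d 0)" for k
      using that by (simp add: st0 homogeneous_one)
    show "graded_mat (?d i) (?d (Suc i)) (?\<phi> i)" for i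
      using P[of i] Q[of i] by (simp add: P_def Q_def linear_cover_def)
    show "\<exists>v\<in>carrier_vec (length (?d 0)). f - ?g \<bullet> v \<in> I" for f
      using I by (intro bexI[of _ "vec 1 (\<lambda>_. f)"]) (simp_all add: st0 scalar_prod_1)
    show "mat_image (?\<phi> 0) = {v \<in> carrier_vec (length (?d 0)). ?g \<bullet> v \<in> I}"
      unfolding st0 by (auto simp: im scalar_prod_1)
    show "mat_image (?\<phi> (Suc i)) = mat_kernel (?\<phi> i)" for i
      using Q[of i] by (simp add: Q_def)
    show "elements_mat (?\<phi> i) \<subseteq> irrelevant_ideal" for i
      using P[of i] linear_cover_elements[of "?d i" "a + int i" "?\<phi> i"] by (simp add: P_def)
  qed
  then show ?thesis by blast
qed

text \<open>Since 1 is attained modulo \<open>I\<close> and \<open>I\<close> lies in the irrelevant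
  ideal, some entry of \<open>g\<close> is a nonzero scalar. Any further basis vector would be
  redundant, against minimality, so the module in homological degree 0 is the ring itself.\<close>

lemma minimal_augmentation:
  fixes I :: "('v, 'k::field) mpoly set"
  assumes res: "minimal_graded_free_resolution I d g \<phi>"
    and sub: "ideal.subspace I" and irr: "I \<subseteq> irrelevant_ideal"
  shows "d 0 = [0]" and "mat_image (\<phi> 0) = {v \<in> carrier_vec 1. v $ 0 \<in> I}"
proof -
  define n where "n = length (d 0)"
  have gc: "g \<in> carrier_vec n" and gh: "\<And>k. k < n \<Longrightarrow> homogeneous (d 0 ! k) (g $ k)"
    and aug: "\<And>f. \<exists>v\<in>carrier_vec n. f - g \<bullet> v \<in> I"
    and im: "mat_image (\<phi> 0) = {v \<in> carrier_vec n. g \<bullet> v \<in> I}"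
    and el: "elements_mat (\<phi> 0) \<subseteq> irrelevant_ideal"
    and gr: "graded_mat (d 0) (d (Suc 0)) (\<phi> 0)"
    using res by (auto simp: minimal_graded_free_resolution_def n_def)
  obtain v where v: "v \<in> carrier_vec n" "1 - g \<bullet> v \<in> I"
    using aug by blast
  have "(\<Sum>k<n. Poly_Mapping.lookup (g $ k) 0 * Poly_Mapping.lookup (v $ k) 0) =
      Poly_Mapping.lookup (g \<bullet> v) 0"
    using v(1) by (simp add: scalar_prod_def lookup_sum lookup_mult_0 lessThan_atLeast0)
  also have "\<dots> = 1"
    using v(2) irr by (auto simp: mem_irrelevant_ideal lookup_minus dest!: subsetD)
  finally obtain k where k: "k < n" "Poly_Mapping.lookup (g $ k) 0 \<noteq> 0"
    by (metis (no_types, lifting) lessThan_iff mult_zero_left sum.neutral zero_neq_one)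
  have dk: "d 0 ! k = 0"
    using homogeneous_lookup_0[OF gh[OF k(1)] k(2)] .
  define c where "c = Poly_Mapping.lookup (g $ k) 0"
  have "homogeneous 0 (g $ k)"
    using gh[OF k(1)] by (simp only: dk)
  then have gk: "g $ k = Poly_Mapping.single 0 c"
    unfolding c_def by (rule homogeneous_0_eq)
  define u where "u = (Poly_Mapping.single 0 (1 / c) :: ('v, 'k) mpoly)"
  have "c \<noteq> 0"
    using k(2) by (simp only: c_def not_False_eq_True)
  then have u: "u * g $ k = 1"
    by (simp add: gk u_def mult_single)
  have single: "l = k" if l: "l < n" for l
  proof (rule ccontr)
    assume "l \<noteq> k"
    \<comment> \<open>This vector is sent to 0 by \<open>g\<close>, hence lies in the image of
      \<open>\<phi> 0\<close>; but its entry at \<open>l\<close> is 1.\<close>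
    define w where "w = unit_vec n l - (g $ l * u) \<cdot>\<^sub>v unit_vec n k"
    have wc: "w \<in> carrier_vec n"
      by (auto simp: w_def intro!: minus_carrier_vec)
    have "g \<bullet> w = g \<bullet> unit_vec n l - g \<bullet> ((g $ l * u) \<cdot>\<^sub>v unit_vec n k)"
      unfolding w_def using gc by (intro scalar_prod_minus_distrib) auto
    also have "\<dots> = g $ l - g $ l * (u * g $ k)"
      by (simp only: scalar_prod_smult_distrib[OF gc unit_vec_carrier] scalar_prod_right_unit[OF l]
          scalar_prod_right_unit[OF k(1)] mult.assoc)
    finally have "g \<bullet> w \<in> I"
      using sub by (simp add: u ideal.subspace_0)
    with wc have "w \<in> mat_image (\<phi> 0)"
      by (simp add: im)
    then have "w $ l \<in> irrelevant_ideal"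
      using mat_image_irrelevant[OF graded_matD(1)[OF gr] el, of w l] l by (simp add: n_def)
    moreover have "w $ l = 1"
      using l k(1) \<open>l \<noteq> k\<close> by (simp add: w_def)
    ultimately show False
      by (simp add: mem_irrelevant_ideal)
  qed
  have "k = 0" using single[of 0] k(1) by simp
  moreover have n: "n = 1" using single[of 0] single[of 1] k(1) by (cases "n = 1") auto
  ultimately show "d 0 = [0]"
    using dk by (cases "d 0") (auto simp: n_def)
  have "g \<bullet> v \<in> I \<longleftrightarrow> v $ 0 \<in> I" if "v \<in> carrier_vec 1" for v
  proof
    assume "g \<bullet> v \<in> I"
    then have "u * (g \<bullet> v) \<in> I"
      by (rule ideal.subspace_scale[OF sub])
    then show "v $ 0 \<in> I"
      using u \<open>k = 0\<close> by (simp add: scalar_prod_1[OF that] flip: mult.assoc)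
  next
    assume "v $ 0 \<in> I"
    then show "g \<bullet> v \<in> I"
      unfolding scalar_prod_1[OF that] by (rule ideal.subspace_scale[OF sub])
  qed
  then show "mat_image (\<phi> 0) = {v \<in> carrier_vec 1. v $ 0 \<in> I}"
    unfolding im n by blast
qed

text \<open>The resolution here is arbitrary, so its maps need not have linear quotients. What is
  carried along it is a linear cover with the same image as \<open>\<phi> i\<close>.\<close>

lemma minimal_resolution_shifts:
  fixes A :: "('v::finite, 'k::field) mpoly mat"
  assumes cover: "linear_cover [0] a A" and im: "mat_image A = {v \<in> carrier_vec 1. v $ 0 \<in> I}"
    and a: "0 < a" and sub: "ideal.subspace I" and I: "I \<noteq> {0}"
    and res: "minimal_graded_free_resolution I d g \<phi>"
  shows "d 0 = [0]" and "d (Suc i) = replicate (length (d (Suc i))) (a + int i)" and "d 1 \<noteq> []"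
proof -
  have Ac: "A \<in> carrier_mat 1 (dim_col A)"
    using graded_matD(1)[of "[0]" "replicate (dim_col A) a" A] cover
    unfolding linear_cover_def length_replicate by (auto simp only: list.size One_nat_def add_0)
  have irr: "I \<subseteq> irrelevant_ideal"
  proof
    fix p assume "p \<in> I"
    then have "vec 1 (\<lambda>_. p) \<in> mat_image A"
      by (simp add: im)
    with mat_image_irrelevant[OF Ac linear_cover_elements[OF cover]] a
    show "p \<in> irrelevant_ideal" by fastforce
  qed
  note aug = minimal_augmentation[OF res sub irr]
  show d0: "d 0 = [0]" by (rule aug(1))
  have gr: "graded_mat (d i) (d (Suc i)) (\<phi> i)" and ex: "mat_image (\<phi> (Suc i)) = mat_kernel (\<phi> i)"
    and el: "elements_mat (\<phi> i) \<subseteq> irrelevant_ideal" for i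
    using res by (auto simp: minimal_graded_free_resolution_def)
  \<comment> \<open>Exactness and minimality one step further on show that the columns of
    \<open>\<phi> i\<close> are minimal generators.\<close>
  have ker: "w $ k \<in> irrelevant_ideal" if "w \<in> mat_kernel (\<phi> i)" "k < length (d (Suc i))" for i w k
    using mat_image_irrelevant[OF graded_matD(1)[OF gr] el, of w "Suc i"] that by (simp add: ex)
  have cov: "\<exists>B. linear_cover (d i) (a + int i) B \<and> mat_image B = mat_image (\<phi> i)" for i
  proof (induction i)
    case 0
    then show ?case using cover im aug by auto
  next
    case (Suc i)
    then obtain B where B: "linear_cover (d i) (a + int i) B" "mat_image (\<phi> i) = mat_image B"
      by auto
    from linear_cover_transport[OF B(1) gr B(2) ker[of _ i]]
    show ?case by (auto simp: ex add.assoc add.commute[of 1])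
  qed
  show "d (Suc i) = replicate (length (d (Suc i))) (a + int i)"
  proof -
    from cov obtain B where B: "linear_cover (d i) (a + int i) B" "mat_image (\<phi> i) = mat_image B"
      by metis
    from linear_cover_transport[OF B(1) gr B(2) ker[of _ i]] show ?thesis by blast
  qed
  show "d 1 \<noteq> []"
  proof
    assume "d 1 = []"
    then have "\<phi> 0 \<in> carrier_mat 1 0"
      using graded_matD(1)[OF gr[of 0]] d0 by simp
    then have "v $ 0 = 0" if "v \<in> mat_image (\<phi> 0)" for v
      using that by (auto simp: mat_image_def scalar_prod_def)
    moreover obtain p where p: "p \<in> I" "p \<noteq> 0"
      using I sub ideal.subspace_0[OF sub] by blast
    moreover have "vec 1 (\<lambda>_. p) \<in> mat_image (\<phi> 0)"
      using p by (simp add: aug(2))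
    ultimately show False by fastforce
  qed
qed

text \<open>Homological degree 0 contributes the value 0, and degree \<open>Suc k\<close> can
  contribute only \<open>a + k - (k + 1) = a - 1\<close>. Since \<open>I\<close> is nonzero, degree
  1 does contribute, and \<open>a - 1\<close> is the maximum because \<open>a\<close> is
  positive.\<close>

lemma regularity_linear:
  fixes A :: "('v::finite, 'k::field) mpoly mat"
  assumes cover: "linear_cover [0] a A" and im: "mat_image A = {v \<in> carrier_vec 1. v $ 0 \<in> I}"
    and a: "0 < a" and sub: "ideal.subspace I" and I: "I \<noteq> {0}"
  shows "regularity I = a - 1"
proof -
  have "\<exists>g \<phi>. minimal_graded_free_resolution I (minimal_shifts I) g \<phi>"
    unfolding minimal_shifts_def
    by (rule someI_ex[where P = "\<lambda>d. \<exists>g \<phi>. minimal_graded_free_resolution I d g \<phi>"])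
      (rule exists_minimal_graded_free_resolution[OF cover im a ideal.subspace_0[OF sub]])
  then obtain g \<phi> where res: "minimal_graded_free_resolution I (minimal_shifts I) g \<phi>"
    by blast
  note shifts = minimal_resolution_shifts[OF cover im a sub I res]
  have "{j - int i | i j. betti I i j \<noteq> 0} = {0, a - 1}"
  proof (intro equalityI subsetI)
    fix x assume "x \<in> {j - int i | i j. betti I i j \<noteq> 0}"
    then obtain i j where x: "x = j - int i" and "betti I i j \<noteq> 0"
      by blast
    then have j: "j \<in> set (minimal_shifts I i)"
      by (simp add: betti_def count_list_0_iff)
    show "x \<in> {0, a - 1}"
    proof (cases i)
      case 0
      with j x show ?thesis by (simp add: shifts(1))
    next
      case (Suc k)
      with j have "j = a + int k"
        using shifts(2)[of k] by (metis in_set_replicate)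
      with x Suc show ?thesis by simp
    qed
  next
    have 0: "\<exists>i j. 0 = j - int i \<and> betti I i j \<noteq> 0"
      by (intro exI[of _ 0]) (simp add: betti_def shifts(1))
    have "a \<in> set (minimal_shifts I 1)"
      using shifts(2)[of 0] shifts(3) by (metis One_nat_def add_0_right in_set_replicate length_0_conv of_nat_0)
    then have 1: "\<exists>i j. a - 1 = j - int i \<and> betti I i j \<noteq> 0"
      by (intro exI[of _ 1] exI[of _ a]) (simp add: betti_def count_list_0_iff)
    fix x assume "x \<in> {0, a - 1}"
    with 0 1 show "x \<in> {j - int i | i j. betti I i j \<noteq> 0}"
      by blast
  qed
  with a show ?thesis
    by (simp add: regularity_def)
qed

section \<open>Squarefree Veronese ideals\<close>

text \<open>Otherwise all labels in \<open>A - B\<close> exceed all labels in \<open>B - A\<close>;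
  these sets have the same size, so \<open>A\<close> would have the larger sum. Equal sums are
  allowed, which covers ties in the ordering by label sums.\<close>

lemma exchange_lowering_sum:
  fixes e :: "'a \<Rightarrow> nat"
  assumes inj: "inj e" and fin: "finite A" "finite B" and card: "card A = card B"
    and ne: "A \<noteq> B" and le: "sum e A \<le> sum e B"
  shows "\<exists>t\<in>A - B. \<exists>s\<in>B - A. e t < e s"
proof (rule ccontr)
  assume "\<not> ?thesis"
  then have ge: "e s < e t" if "t \<in> A - B" "s \<in> B - A" for t s
    using that inj by (metis DiffD1 DiffD2 injD linorder_neqE_nat)
  have c: "card (B - A) = card (A - B)"
    using fin card by (intro le_antisym card_le_sym_Diff) simp_all
  then obtain h where h: "bij_betw h (B - A) (A - B)"
    using fin by (metis finite_Diff finite_same_card_bij)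
  have "B - A \<noteq> {}"
    using card ne fin by (metis Diff_eq_empty_iff card_subset_eq)
  then have "sum e (B - A) < (\<Sum>s\<in>B - A. e (h s))"
    using fin ge[OF bij_betw_apply[OF h]] by (intro sum_strict_mono) simp_all
  also have "\<dots> = sum e (A - B)"
    by (rule sum.reindex_bij_betw[OF h])
  finally have "sum e (B - A) < sum e (A - B)" .
  moreover have "sum e A = sum e (A - B) + sum e (A \<inter> B)" "sum e B = sum e (B - A) + sum e (A \<inter> B)"
    using fin by (simp_all add: sum.Int_Diff[of A e B] sum.Int_Diff[of B e A] Int_commute)
  ultimately show False
    using le by simp
qed

text \<open>The squarefree monomials of degree \<open>r\<close>, ordered by label sum, form the
  single row of \<open>A\<close>. Exchanging a vertex for one with a smaller label leads to an
  earlier generator, so the colon ideals are generated by variables.\<close>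

lemma sqfree_veronese_linear_cover:
  fixes r :: nat
  defines "I \<equiv> ideal_gen (sqfree ` {B :: 'v::finite set. card B = r}) :: ('v, 'k::field) mpoly set"
  shows "\<exists>A. linear_cover [0] (int r) A \<and> mat_image A = {v \<in> carrier_vec 1. v $ 0 \<in> I}"
proof -
  obtain e :: "'v \<Rightarrow> nat" where e: "inj e"
    using finite_imp_inj_to_nat_seg[of "UNIV :: 'v set"] by auto
  obtain xs0 where xs0: "set xs0 = {B :: 'v set. card B = r}" "distinct xs0"
    using finite_distinct_list[of "{B :: 'v set. card B = r}"] by auto
  define xs where "xs = sort_key (sum e) xs0"
  have xs: "set xs = {B. card B = r}" "distinct xs" "sorted (map (sum e) xs)"
    by (simp_all add: xs_def xs0)
  define n where "n = length xs"
  define X where "X q = xs ! q" for q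
  have cardX: "card (X q) = r" if "q < n" for q
    using nth_mem[of q xs] that xs(1) by (simp add: X_def n_def)
  have X_mono: "sum e (X q) \<le> sum e (X p)" if "q \<le> p" "p < n" for p q
    using sorted_nth_mono[OF xs(3) that(1)] that by (simp add: X_def n_def)
  have X_inj: "X q = X p \<longleftrightarrow> q = p" if "q < n" "p < n" for p q
    using that xs(2) by (simp add: X_def n_def nth_eq_iff_index_eq)
  have X_surj: "\<exists>q<n. X q = B" if "card B = r" for B
    using that xs(1) by (metis (mono_tags) X_def in_set_conv_nth mem_Collect_eq n_def)
  have I: "I = ideal_gen ((\<lambda>q. sqfree (X q)) ` {..<n})"
  proof -
    have "{B. card B = r} = X ` {..<n}"
      using cardX X_surj by auto
    then show ?thesis
      by (simp only: I_def image_image)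
  qed
  define A where "A = (mat 1 n (\<lambda>(_, q). sqfree (X q)) :: ('v, 'k) mpoly mat)"
  have Ac: "A \<in> carrier_mat 1 n" by (simp add: A_def)
  have A_mult: "(A *\<^sub>v w) $ 0 = (\<Sum>q<n. sqfree (X q) * w $ q)" if "w \<in> carrier_vec n" for w
    using mult_mat_vec_nth[OF Ac that, of 0] by (simp add: A_def)
  have ker: "w \<in> mat_kernel A \<longleftrightarrow> w \<in> carrier_vec n \<and> (\<Sum>q<n. sqfree (X q) * w $ q) = 0" for w
  proof -
    have "A *\<^sub>v w = 0\<^sub>v 1 \<longleftrightarrow> (A *\<^sub>v w) $ 0 = 0"
      using Ac by (auto simp: vec_eq_iff)
    then show ?thesis
      by (cases "w \<in> carrier_vec n")
        (simp_all only: mat_kernel[OF Ac] mem_Collect_eq A_mult simp_thms)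
  qed
  have image: "mat_image A = {v \<in> carrier_vec 1. v $ 0 \<in> I}"
  proof (intro equalityI subsetI)
    fix v assume "v \<in> mat_image A"
    then obtain w where w: "w \<in> carrier_vec n" "v = A *\<^sub>v w"
      using Ac by (auto simp: mat_image_def)
    have "v $ 0 \<in> I"
      unfolding w(2) A_mult[OF w(1)] I
      by (intro ideal.span_sum ideal_gen_mult_right ideal.span_base imageI)
    then show "v \<in> {v \<in> carrier_vec 1. v $ 0 \<in> I}"
      using w Ac by auto
  next
    fix v :: "('v, 'k) mpoly vec" assume v: "v \<in> {v \<in> carrier_vec 1. v $ 0 \<in> I}"
    then obtain c where c: "v $ 0 = (\<Sum>q<n. c q * sqfree (X q))"
      using mem_ideal_gen_image[of "{..<n}" "v $ 0" "\<lambda>q. sqfree (X q)"] by (auto simp: I)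
    have "v = A *\<^sub>v vec n c"
      using v Ac A_mult[of "vec n c"] by (intro eq_vecI) (auto simp: c mult.commute)
    then show "v \<in> mat_image A"
      using Ac by (auto simp: mat_image_def)
  qed
  \<comment> \<open>The generating variables are those \<open>t\<close> outside \<open>X i\<close>
    for which an earlier generator divides the product of \<open>var t\<close> and
    \<open>sqfree (X i)\<close>.\<close>
  have lead: "lead_ideal A i = ideal_gen (var ` {t. t \<notin> X i \<and> (\<exists>k<i. X k \<subseteq> insert t (X i))})"
    (is "_ = ideal_gen (var ` ?S)") if i: "i < n" for i
  proof
    show "lead_ideal A i \<subseteq> ideal_gen (var ` ?S)"
    proof
      fix y assume "y \<in> lead_ideal A i"
      then obtain w where w: "w \<in> carrier_vec n" "(\<Sum>q<n. sqfree (X q) * w $ q) = 0"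
          "\<And>q. i < q \<Longrightarrow> q < n \<Longrightarrow> w $ q = 0" "y = w $ i"
        using Ac by (auto simp: lead_ideal_def ker)
      have "0 = sqfree (X i) * w $ i + (\<Sum>q\<in>{..<n} - {i}. sqfree (X q) * w $ q)"
        using i by (subst sum.remove[symmetric]) (auto simp: w(2))
      then have "y * sqfree (X i) = - (\<Sum>q\<in>{..<n} - {i}. sqfree (X q) * w $ q)"
        by (simp add: w(4) eq_neg_iff_add_eq_0 mult.commute)
      also have "\<dots> \<in> ideal_gen (sqfree ` X ` {..<i})"
      proof (intro ideal.span_neg ideal.span_sum)
        fix q assume q: "q \<in> {..<n} - {i}"
        show "sqfree (X q) * w $ q \<in> ideal_gen (sqfree ` X ` {..<i})"
        proof (cases "q < i")
          case True
          then show ?thesis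
            by (intro ideal_gen_mult_right ideal.span_base) auto
        next
          case False
          with q have "w $ q = 0" by (intro w(3)) auto
          then show ?thesis by (simp add: ideal.span_zero)
        qed
      qed
      finally have mem: "y * sqfree (X i) \<in> ideal_gen (sqfree ` X ` {..<i})" .
      show "y \<in> ideal_gen (var ` ?S)"
        unfolding mem_var_ideal
      proof
        fix k assume k: "k \<in> Poly_Mapping.keys y"
        obtain j where j: "j < i" "X j \<subseteq> Poly_Mapping.keys k \<union> X i"
          using mult_sqfree_mem_ideal[OF _ _ mem k] by auto
        have "j < n" using j i by simp
        \<comment> \<open>The exchange yields a vertex \<open>t\<close> in the exponent
          \<open>k\<close>, and trading \<open>s\<close> for \<open>t\<close> in \<open>X i\<close>
          gives a set \<open>X p\<close> of smaller label sum, hence an earlier one. This puts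
          \<open>t\<close> into the set of generating variables.\<close>
        then obtain t s where ts: "t \<in> X j - X i" "s \<in> X i - X j" "e t < e s"
          using exchange_lowering_sum[OF e, of "X j" "X i"] X_mono[of j i] cardX[of j] cardX[of i]
            X_inj[of j i] j i by auto
        have "card (insert t (X i - {s})) = r"
          using ts cardX[OF i] by (simp add: card_insert_if card_Diff_singleton) (metis card_gt_0_iff Suc_pred finite empty_iff)
        then obtain p where p: "p < n" "X p = insert t (X i - {s})"
          using X_surj by blast
        have "sum e (X p) < sum e (X i)"
          using ts sum.remove[of "X i" s e] by (simp add: p(2))
        then have "p < i"
          using X_mono[of i p] p(1) by (cases "i \<le> p") auto
        then have "t \<in> ?S"
          using ts p(2) by auto
        moreover have "t \<in> Poly_Mapping.keys k"
          using j ts by auto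
        ultimately show "Poly_Mapping.keys k \<inter> ?S \<noteq> {}"
          by blast
      qed
    qed
    show "ideal_gen (var ` ?S) \<subseteq> lead_ideal A i"
    proof (rule ideal.span_minimal)
      show "ideal.subspace (lead_ideal A i)"
        using i Ac by (intro subspace_lead_ideal) simp
      show "var ` ?S \<subseteq> lead_ideal A i"
      proof safe
        fix t k assume t: "t \<notin> X i" and k: "k < i" "X k \<subseteq> insert t (X i)"
        have kn: "k < n" using k i by simp
        \<comment> \<open>Exactly one vertex \<open>s\<close> is missing from \<open>X k\<close>, so
          multiplying by \<open>var s\<close> and by \<open>var t\<close> leads to the same monomial
          and gives a linear syzygy ending at \<open>i\<close>.\<close>
        have "card (insert t (X i) - X k) = 1"
          using t k cardX[OF i] cardX[OF kn] by (simp add: card_Diff_subset)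
        then obtain s where s: "insert t (X i) - X k = {s}"
          by (auto simp: card_1_singleton_iff)
        then have "s \<notin> X k" "insert s (X k) = insert t (X i)"
          using k(2) by auto
        then have eq: "var s * sqfree (X k) = (var t * sqfree (X i) :: ('v, 'k) mpoly)"
          using t by (metis finite prod.insert sqfree_def)
        define w where "w = vec n (\<lambda>q. if q = i then var t else if q = k then - var s else (0 :: ('v, 'k) mpoly))"
        have "(\<Sum>q<n. sqfree (X q) * w $ q) = (\<Sum>q\<in>{i, k}. sqfree (X q) * w $ q)"
          using i kn by (intro sum.mono_neutral_right) (auto simp: w_def)
        also have "\<dots> = 0"
          using i kn k(1) eq by (simp add: w_def mult.commute)
        finally have "w \<in> mat_kernel A"
          by (simp add: ker w_def)
        then show "var t \<in> lead_ideal A i"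
          unfolding lead_ideal_def using i k Ac by (auto simp: w_def intro!: exI[of _ w])
      qed
    qed
  qed
  have "graded_mat [0] (replicate n (int r)) A"
    using Ac homogeneous_sqfree[of "X _"] cardX by (auto simp: graded_mat_def A_def)
  then have "linear_cover [0] (int r) A"
    unfolding linear_cover_def using lead Ac by auto
  then show ?thesis
    using image by blast
qed

section \<open>Complete graphs\<close>

text \<open>Any two distinct vertices of \<open>A\<close> are joined by an arc, which survives in
  the induced subgraph. The set must be nonempty because a connected graph has a vertex.\<close>

lemma connected_induce_complete:
  assumes "K\<^bsub>n\<^esub> G" "A \<subseteq> verts G" "A \<noteq> {}"
  shows "connected (G \<restriction> A)"
proof -
  interpret graph G using assms(1) by (simp add: complete_digraph_def)
  have arcs: "(u, v) \<in> arcs_ends (G \<restriction> A)" if "u \<in> A" "v \<in> A" "u \<noteq> v" for u v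
  proof -
    have "(u, v) \<in> arcs_ends G"
      using assms that by (auto simp: complete_digraph_def)
    then show ?thesis
      using that by (auto simp: arcs_ends_def arc_to_ends_def)
  qed
  have "(u, v) \<in> rtrancl_on A ((arcs_ends (G \<restriction> A))\<^sup>s)" if "u \<in> A" "v \<in> A" for u v
  proof (cases "u = v")
    case False
    with arcs that have "(u, v) \<in> (arcs_ends (G \<restriction> A))\<^sup>s"
      by (simp add: symcl_def)
    then show ?thesis
      using that by (intro rtrancl_on_into_rtrancl_on[OF rtrancl_on_refl])
  qed (use that in auto)
  then show ?thesis
    using assms(3) by (simp add: connected_conv)
qed

theorem corollary4p2:
  fixes G :: "('v::finite, 'e) pre_digraph" and n r :: nat
  assumes "K\<^bsub>n\<^esub> G" and "verts G = UNIV"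
    and "0 < r" and "r < n"
  shows "regularity (conn_ideal r G :: ('v, 'k::field) mpoly set) = int r"
proof -
  let ?\<B> = "{B :: 'v set. card B = r + 1}"
  let ?I = "ideal_gen (sqfree ` ?\<B>) :: ('v, 'k) mpoly set"
  have "connected (G \<restriction> B)" if "card B = r + 1" for B
    using that assms(1,2) by (intro connected_induce_complete) auto
  then have "conn_ideal r G = ?I"
    unfolding conn_ideal_def sqfree_def using assms(2)
    by (intro arg_cong[where f = ideal_gen]) auto
  moreover obtain A where "linear_cover [0] (int (r + 1)) A"
      "mat_image A = {v \<in> carrier_vec 1. v $ 0 \<in> ?I}"
    using sqfree_veronese_linear_cover[of "r + 1"] by blast
  \<comment> \<open>Here \<open>r < n\<close> enters: it provides a set of \<open>r + 1\<close>
    vertices, and thus a generator.\<close>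
  moreover have "?I \<noteq> {0}"
  proof -
    have "r + 1 \<le> card (UNIV :: 'v set)"
      using assms by (simp add: complete_digraph_def)
    then obtain B :: "'v set" where "card B = r + 1"
      using obtain_subset_with_card_n by blast
    then have "sqfree B \<in> ?I"
      by (intro ideal.span_base) simp
    moreover have "sqfree B \<noteq> (0 :: ('v, 'k) mpoly)"
      by (metis keys_single keys_zero one_neq_zero sqfree_eq_single insert_not_empty)
    ultimately show ?thesis by blast
  qed
  ultimately show ?thesis
    \<comment> \<open>The generators have degree \<open>r + 1\<close>, one more than the regularity
      of the quotient.\<close>
    using regularity_linear[of "int (r + 1)" A ?I] by simp
qed

end
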